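(* Let $N\ge1$, $m\ge 2$, $k\ge 2$, $1\le l<k$ be integers with $k\nmid m$, and let $$Y=\big((N-1)(k-1)+l,\ (N-2)(k-1)+l,\ \dots,\ (k-1)+l,\ l\big)$$ be the partition associated with the generalized Wronskian--Hermite polynomial $W_N^{[m,k,l]}(z)$. Represent the $m$-core $\mathrm{core}_m(Y)$ on the $k$-abacus by its $\beta$-numbers taken with $r=\ell(\mathrm{core}_m(Y))$ (the length of the partition $\mathrm{core}_m(Y)$), and let $b_i$ be the number of beads on runner $i$. Then $$b_i=N_i,\qquad i=1,\dots,k-1,$$ where $N_1,\dots,N_{k-1}$ are the integers obtained from $(m,k,l,N)$ by the arithmetic procedure given in the context.
   Context: **Cores and abaci.** The $m$-core $\mathrm{core}_m(\lambda)$ of a partition $\lambda$ is the (unique) partition obtained by successively removing rim $m$-hooks until none can be removed. For a partition $\lambda=(\lambda_1\ge\lambda_2\ge\cdots)$ and $r\ge\ell(\lambda)$, the $\beta$-numbers are $\beta_i=\lambda_i+r-i$, $i=1,\dots,r$ (with $\lambda_i=0$ for $i>\ell(\lambda)$). The $k$-abacus has runners $0,1,\dots,k-1$; runner $a$ consists of the positions $a,a+k,a+2k,\dots$. One bead is placed at each position $\beta_i$, so $b_a=\#\{i:\beta_i\equiv a \bmod k\}$. (The empty partition gives no beads.) **The polynomial (for reference).** $W_N^{[m,k,l]}(z)=c\,\mathrm{Wr}[p_{n_1}^{[m]},\dots,p_{n_N}^{[m]}]$ with $n_i=l+(i-1)k$, $c=\prod_i n_i!/\prod_{i<j}(n_j-n_i)$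 and $\sum_{n\ge0}p^{[m]}_n(z)\epsilon^n=\exp(z\epsilon+\epsilon^m)$. **Procedure defining $N_i$.** Let $d=\gcd(m,k)$, $\widehat m=m/d$, $\widehat k=k/d$, $m_1=\lfloor m/k\rfloor$, $k_N=\lfloor N/\widehat m\rfloor$; let $m_0\equiv m\pmod k$ with $1\le m_0\le k-1$ and $N_0\equiv N\pmod{\widehat m}$ with $0\le N_0\le\widehat m-1$. First define $\hat N_i$, $0\le i\le k-1$. *Case I:* $0\le N_0<\lfloor l/m_0\rfloor m_1+m_1+1$. If $m_1\ne0$: $\hat N_i=m_1$ for $i=l-(j-1)m_0$, $1\le j\le\lfloor N_0/m_1\rfloor$; $\hat N_i=N_0\bmod m_1$ for $i=l-\lfloor N_0/m_1\rfloor m_0$; $\hat N_i=0$ otherwise. If $m_1=0$ (then $N_0=0$): all $\hat N_i=0$. *Case II:* $N_0\ge\lfloor l/m_0\rfloor m_1+m_1+1$. Let $r$, $1\le r\le m_0/d$, be the integer with $\lfloor\frac{l+(r-1)k}{m_0}\rfloor m_1+m_1+r\le N_0<\lfloor\frac{l+rk}{m_0}\rfloor m_1+m_1+r+1$. If $m_1\neq0$: - $\hat N_i=m_1+1$ for $i=(l+(j-1)k)\bmod m_0$, $1\le j\le r$; - $\hat N_i=m_1$ for $i=l-(j-1)m_0$ with $1\le j\le\lfloor\frac{l}{m_0}\rfloor$; for $i=l+tk-(j-1)m_0$ with $\lfloor\frac{l+(t-1)k}{m_0}\rfloor+1<j\le\lfloor\frac{l+tk}{m_0}\rfloor$, $t=1,\dots,r-1$;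 and for $i=l+rk-(j-1)m_0$ with $\lfloor\frac{l+(r-1)k}{m_0}\rfloor+1<j\le\lfloor\frac{N_0-r}{m_1}\rfloor$; - $\hat N_i=(N_0-r)\bmod m_1$ for $i=l+rk-\lfloor\frac{N_0-r}{m_1}\rfloor m_0$; - $\hat N_i=0$ otherwise. If $m_1=0$ (then $r=N_0$, $m_0=m$): $\hat N_i=1$ for $i=(l+(j-1)k)\bmod m$, $1\le j\le N_0$, and $\hat N_i=0$ otherwise. Then define $N_i$, $1\le i\le k-1$. *Case 1:* $d=1$. (i) If $\hat N_0=0$: $N_i=\hat N_i$. (ii) If $\hat N_i\ne0$ for $0\le i\le j-1$ and $\hat N_j=0$ for some $1\le j<k$: $N_i=\hat N_{i+j}$ for $1\le i\le k-j-1$ and $N_i=\hat N_{i+j-k}-1$ for $k-j\le i<k$. (iii) If all $\hat N_i\ne0$: put $\bar r=\min_i\hat N_i$, $\bar N_i=\hat N_i-\bar r$, and apply (i) or (ii) with $\bar N$ in place of $\hat N$. *Case 2:* $d\ne1$. Let $l_1=l\bmod d$ ($0\le l_1\le d-1$), $l_j=l_1+(j-1)d$ for $1\le j\le\widehat k$; $\tilde N^{(1)}_{l_j}=\lfloor k_N\widehat m/\widehat k\rfloor+1$ for $1\le j\le k_N\widehat m\bmod\widehat k$ and $\tilde N^{(1)}_{l_j}=\lfloor k_N\widehat m/\widehat k\rfloor$ for $k_N\widehat m\bmod\widehat k<j\le\widehat k$. With $e=(k_Nm)\bmod k$: $\tilde N^{(2)}_{l_j}=\tilde N^{(1)}_{l_j}+\hat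 N_{l_j+k-e}$ if $0\le l_j<e$, and $\tilde N^{(2)}_{l_j}=\tilde N^{(1)}_{l_j}+\hat N_{l_j-e}$ if $e\le l_j<k$. If $d\nmid l$: $N_i=\tilde N^{(2)}_{l_j}$ for $i=l_j$ ($1\le j\le\widehat k$), $N_i=0$ otherwise. If $d\mid l$ (so $l_1=0$): when $\tilde N^{(2)}_0=0$, $N_i=\tilde N^{(2)}_{l_j}$ for $i=l_j$, $2\le j\le\widehat k$, and $N_i=0$ otherwise; when $\tilde N_0^{(2)}>0$, $N_{k-1}=\tilde N^{(2)}_0-1$, $N_i=\tilde N^{(2)}_{l_j}$ for $i=l_j-1$, $2\le j\le\widehat k$, and $N_i=0$ otherwise. *)

theory Defs
  imports Main
begin

section \<open>Partitions, rim hooks and cores\<close>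

definition is_partition :: "nat list \<Rightarrow> bool" where
  "is_partition lam \<longleftrightarrow> sorted_wrt (\<ge>) lam \<and> 0 \<notin> set lam"

text \<open>Parts, rows and columns are numbered from 1; a partition is continued by zeros.\<close>

definition part :: "nat list \<Rightarrow> nat \<Rightarrow> nat" where
  "part lam i = (if 1 \<le> i \<and> i \<le> length lam then lam ! (i - 1) else 0)"

definition diagram :: "nat list \<Rightarrow> (nat \<times> nat) set" where
  "diagram lam = {(i, j). 1 \<le> i \<and> 1 \<le> j \<and> j \<le> part lam i}"

definition rim :: "nat list \<Rightarrow> (nat \<times> nat) set" where
  "rim lam = {(i, j) \<in> diagram lam. (i + 1, j + 1) \<notin> diagram lam}"

definition adjacent :: "nat \<times> nat \<Rightarrow> nat \<times> nat \<Rightarrow> bool" where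
  "adjacent x y \<longleftrightarrow>
     fst x = fst y \<and> (snd x = snd y + 1 \<or> snd y = snd x + 1) \<or>
     snd x = snd y \<and> (fst x = fst y + 1 \<or> fst y = fst x + 1)"

definition connected_cells :: "(nat \<times> nat) set \<Rightarrow> bool" where
  "connected_cells R \<longleftrightarrow>
     (\<forall>x\<in>R. \<forall>y\<in>R. (x, y) \<in> {(u, v). u \<in> R \<and> v \<in> R \<and> adjacent u v}\<^sup>*)"

text \<open>A rim \<open>m\<close>-hook is a connected part of the rim, with \<open>m\<close> cells, whose removal
  leaves the diagram of a partition.\<close>

definition removes_rim_hook :: "nat \<Rightarrow> nat list \<Rightarrow> nat list \<Rightarrow> bool" where
  "removes_rim_hook m lam mu \<longleftrightarrow> is_partition lam \<and> is_partition mu \<and>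
     (\<exists>R. R \<subseteq> rim lam \<and> card R = m \<and> connected_cells R \<and>
          diagram mu = diagram lam - R)"

definition core :: "nat \<Rightarrow> nat list \<Rightarrow> nat list" where
  "core m lam = (THE mu. (removes_rim_hook m)\<^sup>*\<^sup>* lam mu \<and> (\<nexists>nu. removes_rim_hook m mu nu))"


section \<open>Beta numbers and the abacus\<close>

text \<open>For \<open>r \<ge> length lam\<close> and \<open>1 \<le> i \<le> r\<close>.\<close>

definition beta :: "nat list \<Rightarrow> nat \<Rightarrow> nat \<Rightarrow> nat" where
  "beta lam r i = part lam i + r - i"

definition beads :: "nat \<Rightarrow> nat list \<Rightarrow> nat \<Rightarrow> nat \<Rightarrow> nat" where
  "beads k lam r a = card {i \<in> {1..r}. beta lam r i mod k = a}"


section \<open>The partition of the generalized Wronskian--Hermite polynomial\<close>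

definition WH_partition :: "nat \<Rightarrow> nat \<Rightarrow> nat \<Rightarrow> nat list" where
  "WH_partition N k l = map (\<lambda>i. (N - i) * (k - 1) + l) [1..<N + 1]"


section \<open>The arithmetic procedure\<close>

text \<open>The procedure is carried out in the integers, because positions such as \<open>l - (j - 1) * m0\<close>
  may become negative (the value prescribed there is then irrelevant) and to avoid truncated
  subtraction. Throughout, \<open>m0 = m mod k\<close>, \<open>m1\<close> is the floor of \<open>m / k\<close> and \<open>N0\<close> is the
  residue of \<open>N\<close> modulo \<open>m / gcd m k\<close>. The number \<open>proc_r\<close> is meaningful only if
  \<open>N0 \<ge> (l div m0) * m1 + m1 + 1\<close>.\<close>

definition proc_r :: "int \<Rightarrow> int \<Rightarrow> int \<Rightarrow> int \<Rightarrow> int" where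
  "proc_r m k l N =
     (let d = gcd m k; m1 = m div k; m0 = m mod k; N0 = N mod (m div d) in
      THE r. 1 \<le> r \<and> r \<le> m0 div d \<and>
             ((l + (r - 1) * k) div m0) * m1 + m1 + r \<le> N0 \<and>
             N0 < ((l + r * k) div m0) * m1 + m1 + r + 1)"

text \<open>Meaningful for \<open>0 \<le> i < k\<close>. Each chain of conditionals lists the positions with a prescribed
  value, all other positions having value 0.\<close>

definition Nhat :: "int \<Rightarrow> int \<Rightarrow> int \<Rightarrow> int \<Rightarrow> int \<Rightarrow> int" where
  "Nhat m k l N i =
     (let d = gcd m k; m1 = m div k; m0 = m mod k; N0 = N mod (m div d) in
      if N0 < (l div m0) * m1 + m1 + 1 then
        (if m1 \<noteq> 0 then
           (if \<exists>j\<in>{1..N0 div m1}. i = l - (j - 1) * m0 then m1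
            else if i = l - (N0 div m1) * m0 then N0 mod m1
            else 0)
         else 0)
      else
        (let r = proc_r m k l N in
         if m1 \<noteq> 0 then
           (if \<exists>j\<in>{1..r}. i = (l + (j - 1) * k) mod m0 then m1 + 1
            else if (\<exists>j\<in>{1..l div m0}. i = l - (j - 1) * m0) \<or>
                    (\<exists>t\<in>{1..r - 1}. \<exists>j\<in>{(l + (t - 1) * k) div m0 + 1<..(l + t * k) div m0}.
                       i = l + t * k - (j - 1) * m0) \<or>
                    (\<exists>j\<in>{(l + (r - 1) * k) div m0 + 1<..(N0 - r) div m1}.
                       i = l + r * k - (j - 1) * m0)
            then m1
            else if i = l + r * k - ((N0 - r) div m1) * m0 then (N0 - r) mod m1
            else 0)
         else
           (if \<exists>j\<in>{1..N0}. i = (l + (j - 1) * k) mod m then 1 else 0)))"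

text \<open>Renormalization of nonnegative runner counts \<open>h 0, \<dots>, h (k - 1)\<close>, not all nonzero, so that
  runner 0 becomes empty; \<open>j\<close> is the first empty runner.\<close>

definition shift_runners :: "int \<Rightarrow> (int \<Rightarrow> int) \<Rightarrow> int \<Rightarrow> int" where
  "shift_runners k h i =
     (if h 0 = 0 then h i
      else (let j = (THE j. 1 \<le> j \<and> j < k \<and> (\<forall>i\<in>{0..j - 1}. h i \<noteq> 0) \<and> h j = 0) in
            if i \<le> k - j - 1 then h (i + j) else h (i + j - k) - 1))"

definition N_case1 :: "int \<Rightarrow> int \<Rightarrow> int \<Rightarrow> int \<Rightarrow> int \<Rightarrow> int" where
  "N_case1 m k l N i =
     (let h = Nhat m k l N in
      if \<forall>i\<in>{0..k - 1}. h i \<noteq> 0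
      then (let rbar = Min (h ` {0..k - 1}) in shift_runners k (\<lambda>i. h i - rbar) i)
      else shift_runners k h i)"

text \<open>The position \<open>l\<^sub>j\<close>, used when \<open>gcd m k \<noteq> 1\<close>.\<close>

definition lpos :: "int \<Rightarrow> int \<Rightarrow> int \<Rightarrow> int \<Rightarrow> int" where
  "lpos m k l j = (let d = gcd m k in l mod d + (j - 1) * d)"

text \<open>\<open>Ntilde1\<close> and \<open>Ntilde2\<close> are indexed by the positions \<open>x = l\<^sub>j\<close>, \<open>1 \<le> j \<le> k div d\<close>;
  their values at other \<open>x\<close> are irrelevant.\<close>

definition Ntilde1 :: "int \<Rightarrow> int \<Rightarrow> int \<Rightarrow> int \<Rightarrow> int \<Rightarrow> int" where
  "Ntilde1 m k l N x =
     (let d = gcd m k; mh = m div d; kh = k div d; kN = N div mh in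
      if \<exists>j\<in>{1..(kN * mh) mod kh}. x = lpos m k l j then (kN * mh) div kh + 1
      else if \<exists>j\<in>{(kN * mh) mod kh<..kh}. x = lpos m k l j then (kN * mh) div kh
      else 0)"

definition Ntilde2 :: "int \<Rightarrow> int \<Rightarrow> int \<Rightarrow> int \<Rightarrow> int \<Rightarrow> int" where
  "Ntilde2 m k l N x =
     (let d = gcd m k; kN = N div (m div d); e = (kN * m) mod k in
      if x < e then Ntilde1 m k l N x + Nhat m k l N (x + k - e)
      else Ntilde1 m k l N x + Nhat m k l N (x - e))"

definition N_case2 :: "int \<Rightarrow> int \<Rightarrow> int \<Rightarrow> int \<Rightarrow> int \<Rightarrow> int" where
  "N_case2 m k l N i =
     (let d = gcd m k; kh = k div d; T = Ntilde2 m k l N in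
      if \<not> d dvd l then
        (if \<exists>j\<in>{1..kh}. i = lpos m k l j then T i else 0)
      else if T 0 = 0 then
        (if \<exists>j\<in>{2..kh}. i = lpos m k l j then T i else 0)
      else
        (if i = k - 1 then T 0 - 1
         else if \<exists>j\<in>{2..kh}. i = lpos m k l j - 1 then T (i + 1)
         else 0))"

text \<open>The result \<open>N\<^sub>i\<close> of the procedure; meaningful for \<open>1 \<le> i \<le> k - 1\<close>.\<close>

definition N_runner :: "int \<Rightarrow> int \<Rightarrow> int \<Rightarrow> int \<Rightarrow> int \<Rightarrow> int" where
  "N_runner m k l N i = (if gcd m k = 1 then N_case1 m k l N i else N_case2 m k l N i)"

end

theory Submission
  imports Defs
begin

text \<open>Removing a rim \<open>m\<close>-hook replaces a beta number \<open>x\<close> by \<open>x - m\<close>, so the beta set of the \<open>m\<close>-core (taken with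
  the original number \<open>N\<close> of beads) is the unique set \<open>P\<close> that is closed under subtracting \<open>m\<close> and
  has as many elements in each residue class modulo \<open>m\<close> as the initial beta set \<open>{l + j * k | j < N}\<close>.
  The residues of \<open>l + j * k\<close> have period \<open>m div d\<close> with \<open>d = gcd m k\<close>, hence \<open>P\<close> consists of all
  \<open>y < kN * m\<close> with \<open>y \<equiv> l\<close> modulo \<open>d\<close>, together with the translate by \<open>kN * m\<close> of the set \<open>A\<close> of the first \<open>N0\<close>
  residues. Following these residues as they wrap around shows that \<open>A\<close> has \<open>Nhat x\<close> elements on
  runner \<open>x\<close>. Both \<open>A\<close> and \<open>P\<close> are closed under subtracting \<open>k\<close>, so the first gap of \<open>P\<close>, which becomes
  position 0 when the zero parts are dropped, is read off the runner counts: this is the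
  renormalization in the last step of the procedure.\<close>

subsection \<open>Partitions and their beta sets\<close>

definition betas :: "nat list \<Rightarrow> nat \<Rightarrow> nat set" where
  "betas lam r = beta lam r ` {1..r}"

lemma part_antimono:
  assumes "is_partition lam" "1 \<le> i" "i \<le> j"
  shows "part lam j \<le> part lam i"
proof (cases "j \<le> length lam \<and> i < j")
  case True
  have "sorted_wrt (\<ge>) lam" using assms(1) by (simp add: is_partition_def)
  then have "lam ! (i - 1) \<ge> lam ! (j - 1)"
    using sorted_wrt_nth_less[of "(\<ge>)" lam "i - 1" "j - 1"] True assms by auto
  then show ?thesis using True assms by (auto simp: part_def)
next
  case False
  then show ?thesis using assms by (cases "i = j") (auto simp: part_def)
qed

lemma part_pos_iff:
  assumes "is_partition lam"
  shows "0 < part lam i \<longleftrightarrow> 1 \<le> i \<and> i \<le> length lam"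
proof -
  have "lam ! (i - 1) \<noteq> 0" if "1 \<le> i" "i \<le> length lam"
    using that assms nth_mem[of "i - 1" lam] unfolding is_partition_def
    by (metis Suc_pred' less_eq_Suc_le One_nat_def)
  then show ?thesis by (auto simp: part_def)
qed

lemma partition_eqI:
  assumes "is_partition lam" "is_partition mu" "\<And>i. 1 \<le> i \<Longrightarrow> part lam i = part mu i"
  shows "lam = mu"
proof (rule nth_equalityI)
  have "1 \<le> i \<and> i \<le> length lam \<longleftrightarrow> 1 \<le> i \<and> i \<le> length mu" for i
    using part_pos_iff[OF assms(1), of i] part_pos_iff[OF assms(2), of i] assms(3)[of i] by auto
  from this[of "length lam"] this[of "length mu"] show len: "length lam = length mu"
    by (cases "length lam"; cases "length mu") auto
  show "lam ! i = mu ! i" if "i < length lam" for i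
    using assms(3)[of "Suc i"] that len by (auto simp: part_def)
qed

text \<open>A partition as a list contains no zeros, so the trailing zeros of \<open>f\<close> must
  be cut off: the induction lowers the bound \<open>n\<close> until the last value is positive or
  nothing is left.\<close>

lemma exists_partition:
  assumes "\<And>i j. 1 \<le> i \<Longrightarrow> i \<le> j \<Longrightarrow> f j \<le> f i" "\<And>i. n < i \<Longrightarrow> f i = 0"
  shows "\<exists>lam. is_partition lam \<and> length lam \<le> n \<and> (\<forall>i\<ge>1. part lam i = f i)"
  using assms
proof (induction n)
  case 0
  then show ?case by (intro exI[of _ "[]"]) (auto simp: is_partition_def part_def)
next
  case (Suc n)
  show ?case
  proof (cases "f (Suc n) = 0")
    case True
    have "f i = 0" if "n < i" for i
      using that True Suc.prems(2) by (cases "i = Suc n") auto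
    then show ?thesis using Suc.IH[OF Suc.prems(1)] by force
  next
    case False
    let ?lam = "map f [1..<Suc (Suc n)]"
    have "f i \<noteq> 0" if "1 \<le> i" "i \<le> Suc n" for i
      using Suc.prems(1)[OF that] False by linarith
    then have "0 \<notin> set ?lam" by (auto simp del: upt_Suc simp: image_iff)
    moreover have "sorted_wrt (\<ge>) ?lam"
      using Suc.prems(1) by (auto simp: sorted_wrt_iff_nth_less simp del: upt_Suc)
    moreover have "part ?lam i = f i" if "i \<ge> 1" for i
      using that Suc.prems(2)[of i] by (auto simp: part_def simp del: upt_Suc)
    ultimately show ?thesis
      by (intro exI[of _ ?lam]) (simp add: is_partition_def del: upt_Suc)
  qed
qed

lemma beta_strict_antimono:
  assumes "is_partition lam" "1 \<le> i" "i < j" "j \<le> r"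
  shows "beta lam r j < beta lam r i"
  using part_antimono[OF assms(1), of i j] assms by (simp add: beta_def)

lemma beta_less_iff:
  assumes "is_partition lam" "i \<in> {1..r}" "j \<in> {1..r}"
  shows "beta lam r j < beta lam r i \<longleftrightarrow> i < j"
  using beta_strict_antimono[OF assms(1), of i j r] beta_strict_antimono[OF assms(1), of j i r] assms
  by (cases i j rule: linorder_cases) auto

lemma inj_on_beta: "is_partition lam \<Longrightarrow> inj_on (beta lam r) {1..r}"
  by (rule linorder_inj_onI') (metis beta_less_iff less_irrefl)

lemma finite_betas [simp]: "finite (betas lam r)"
  by (simp add: betas_def)

lemma card_betas_above:
  assumes "is_partition lam" "i \<in> {1..r}"
  shows "card {y \<in> betas lam r. beta lam r i < y} = i - 1"
proof -
  have "{y \<in> betas lam r. beta lam r i < y} = beta lam r ` {1..<i}"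
    using assms by (auto simp: betas_def beta_less_iff)
  moreover have "inj_on (beta lam r) {1..<i}"
    using assms(2) by (intro inj_on_subset[OF inj_on_beta[OF assms(1), of r]]) auto
  ultimately show ?thesis by (simp add: card_image)
qed

text \<open>The index of a beta number is one more than the count of larger ones, so the set alone
  determines the sequence up to \<open>r\<close>; later parts are 0 on both sides.\<close>

lemma betas_eqD:
  assumes "is_partition lam" "is_partition mu" "length lam \<le> r" "length mu \<le> r"
    and eq: "betas lam r = betas mu r"
  shows "lam = mu"
proof (rule partition_eqI[OF assms(1,2)])
  fix i :: nat assume "1 \<le> i"
  show "part lam i = part mu i"
  proof (cases "i \<le> r")
    case True
    with \<open>1 \<le> i\<close> have "i \<in> {1..r}" by simp
    then obtain j where j: "j \<in> {1..r}" "beta lam r i = beta mu r j"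
      using eq unfolding betas_def by blast
    then have "i - 1 = j - 1"
      using card_betas_above[OF assms(1) \<open>i \<in> {1..r}\<close>] card_betas_above[OF assms(2) j(1)] eq by simp
    then have "i = j" using j(1) \<open>1 \<le> i\<close> by auto
    then have "part lam i + r - i = part mu i + r - i" using j(2) by (simp add: beta_def)
    then show ?thesis using True by linarith
  next
    case False
    then show ?thesis using assms by (simp add: part_def)
  qed
qed

section \<open>Diagram size and the sum of the beta numbers\<close>

lemma diagram_Sigma: "length lam \<le> n \<Longrightarrow> diagram lam = (SIGMA i:{1..n}. {1..part lam i})"
  by (auto simp: diagram_def part_def split: if_splits)

lemma finite_diagram: "finite (diagram lam)"
  using diagram_Sigma[of lam "length lam"] by simp

lemma card_diagram: "length lam \<le> n \<Longrightarrow> card (diagram lam) = (\<Sum>i=1..n. part lam i)"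
  by (simp add: diagram_Sigma)

text \<open>The second summand depends on \<open>r\<close> only, so a loss of \<open>m\<close> cells
  appears as a drop of the bead sum by \<open>m\<close>.\<close>

lemma sum_betas:
  assumes "is_partition lam" "length lam \<le> r"
  shows "\<Sum>(betas lam r) = card (diagram lam) + (\<Sum>i=1..r. r - i)"
proof -
  have "\<Sum>(betas lam r) = (\<Sum>i=1..r. beta lam r i)"
    unfolding betas_def by (subst sum.reindex[OF inj_on_beta[OF assms(1)]]) simp
  also have "\<dots> = (\<Sum>i=1..r. part lam i + (r - i))"
    by (intro sum.cong) (auto simp: beta_def)
  also have "\<dots> = (\<Sum>i=1..r. part lam i) + (\<Sum>i=1..r. r - i)" by (rule sum.distrib)
  finally show ?thesis unfolding card_diagram[OF assms(2)] .
qed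

subsection \<open>Removing a rim hook moves a bead\<close>

text \<open>Applied to the property of lying in a row up to \<open>i\<close>, this finds a step from
  row \<open>i\<close> to row \<open>i + 1\<close> inside a connected set of cells.\<close>

lemma rtrancl_crossing:
  assumes "(u, v) \<in> E\<^sup>*" "P u" "\<not> P v"
  shows "\<exists>x y. (x, y) \<in> E \<and> P x \<and> \<not> P y"
  using assms by (induction rule: rtrancl_induct) auto

text \<open>Let the hook meet rows \<open>a\<close> to \<open>b\<close>. Connectedness and the rim
  condition force row \<open>i\<close> of \<open>mu\<close>, for \<open>i\<close> from
  \<open>a\<close> to \<open>b - 1\<close>, to carry the bead of row \<open>i + 1\<close> of
  \<open>lam\<close>. Only one bead changes, and the bead sums show that it moves by
  \<open>m\<close>.\<close>

lemma rim_hook_bead_move: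
  assumes rem: "removes_rim_hook m lam mu" and m: "0 < m" and len: "length lam \<le> r"
  shows "length mu \<le> r"
    and "\<exists>y. y + m \<in> betas lam r \<and> y \<notin> betas lam r - {y + m} \<and>
             betas mu r = insert y (betas lam r - {y + m})"
proof -
  obtain R where pl: "is_partition lam" and pm: "is_partition mu"
    and R: "R \<subseteq> rim lam" "card R = m" "connected_cells R" "diagram mu = diagram lam - R"
    using rem unfolding removes_rim_hook_def by auto
  define L M where "L = part lam" and "M = part mu"
  have Rlam: "R \<subseteq> diagram lam" using R(1) by (auto simp: rim_def)
  have le: "M i \<le> L i" for i
  proof (cases "M i = 0")
    case False
    then have "1 \<le> i" using part_pos_iff[OF pm, of i] by (simp add: M_def)
    then have "(i, M i) \<in> diagram mu" using False by (simp add: diagram_def M_def)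
    then have "(i, M i) \<in> diagram lam" using R(4) by auto
    then show ?thesis by (simp add: diagram_def L_def)
  qed simp
  have memR: "(i, j) \<in> R \<longleftrightarrow> 1 \<le> i \<and> M i < j \<and> j \<le> L i" for i j
  proof -
    have "R = diagram lam - diagram mu" using Rlam R(4) by auto
    then show ?thesis by (auto simp: diagram_def L_def M_def)
  qed
  have lenm: "length mu \<le> length lam"
    using le[of "length mu"] part_pos_iff[OF pl, of "length mu"] part_pos_iff[OF pm, of "length mu"]
    by (cases "length mu") (auto simp: L_def M_def)
  then show "length mu \<le> r" using len by simp
  define I where "I = {i. 1 \<le> i \<and> M i < L i}"
  have Isub: "I \<subseteq> {1..length lam}"
    using part_pos_iff[OF pl] by (fastforce simp: I_def L_def)
  then have fin: "finite I" using finite_subset by blast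
  have "R \<noteq> {}" using R(2) m by auto
  then obtain p where "p \<in> R" by auto
  then have "fst p \<in> I" using memR[of "fst p" "snd p"] by (auto simp: I_def)
  then have ne: "I \<noteq> {}" by auto
  define a b where "a = Min I" and "b = Max I"
  have ab: "a \<in> I" "b \<in> I" "\<And>i. i \<in> I \<Longrightarrow> a \<le> i \<and> i \<le> b"
    using fin ne by (auto simp: a_def b_def)
  then have abr: "1 \<le> a" "a \<le> b" "b \<le> r" using Isub len by force+
  \<comment> \<open>A path inside \<open>R\<close> from row \<open>a\<close> to row \<open>b\<close>
    steps down from row \<open>i\<close> to row \<open>i + 1\<close> in some column
    \<open>j\<close>, which gives \<open>M i < j\<close> and \<open>j \<le> L (i + 1)\<close>. As
    the cell \<open>(i, M i + 1)\<close> is on the rim, \<open>L (i + 1)\<close> cannot exceed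
    \<open>M i + 1\<close>.\<close>
  have step: "M i + 1 = L (i + 1)" if "a \<le> i" "i < b" for i
  proof -
    have "(a, L a) \<in> R" "(b, L b) \<in> R" using ab(1,2) memR by (auto simp: I_def)
    then have "((a, L a), (b, L b)) \<in> {(u, v). u \<in> R \<and> v \<in> R \<and> adjacent u v}\<^sup>*"
      using R(3) unfolding connected_cells_def by blast
    from rtrancl_crossing[OF this, of "\<lambda>u. fst u \<le> i"] that
    obtain x y where xy: "x \<in> R" "y \<in> R" "adjacent x y" "fst x \<le> i" "\<not> fst y \<le> i" by auto
    then obtain j where "x = (i, j)" "y = (i + 1, j)"
      by (cases x; cases y) (auto simp: adjacent_def)
    with xy have "(i, j) \<in> R" "(i + 1, j) \<in> R" by auto
    then have "1 \<le> i" "M i < L (i + 1)" and iI: "M i < L i" using memR by auto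
    then have "(i, M i + 1) \<in> rim lam" using memR[of i "M i + 1"] R(1) by auto
    then have "\<not> M i + 2 \<le> L (i + 1)" by (auto simp: rim_def diagram_def L_def)
    then show ?thesis using \<open>M i < L (i + 1)\<close> by simp
  qed
  have same: "M i = L i" if "1 \<le> i" "i \<notin> {a..b}" for i
    using ab(3)[of i] le[of i] that by (force simp: I_def)
  have b1: "beta mu r i = beta lam r (if i < a then i else i + 1)" if "1 \<le> i" "i < b" for i
    using that step[of i] same[of i] abr by (auto simp: beta_def L_def M_def)
  have b2: "beta mu r i = beta lam r i" if "b < i" for i
    using that same[of i] by (auto simp: beta_def L_def M_def)
  define x y where "x = beta lam r a" and "y = beta mu r b"
  have "beta mu r ` ({1..r} - {b}) = beta lam r ` ({1..r} - {a})"
  proof (intro equalityI subsetI)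
    fix z assume "z \<in> beta mu r ` ({1..r} - {b})"
    then obtain i where i: "i \<in> {1..r}" "i \<noteq> b" "z = beta mu r i" by blast
    show "z \<in> beta lam r ` ({1..r} - {a})"
    proof (cases "i < b")
      case True
      then have "(if i < a then i else i + 1) \<in> {1..r} - {a}" using i abr by auto
      then show ?thesis using b1[of i] True i by (metis atLeastAtMost_iff imageI)
    next
      case False
      then show ?thesis using b2[of i] i abr by auto
    qed
  next
    fix z assume "z \<in> beta lam r ` ({1..r} - {a})"
    then obtain i where i: "i \<in> {1..r}" "i \<noteq> a" "z = beta lam r i" by blast
    consider "i < a" | "a < i" "i \<le> b" | "b < i" using i by linarith
    then show "z \<in> beta mu r ` ({1..r} - {b})"
    proof cases
      case 1
      then show ?thesis using b1[of i] i abr by (intro image_eqI[of _ _ i]) auto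
    next
      case 2
      then show ?thesis using b1[of "i - 1"] i abr by (intro image_eqI[of _ _ "i - 1"]) auto
    next
      case 3
      then show ?thesis using b2[of i] i abr by (intro image_eqI[of _ _ i]) auto
    qed
  qed
  moreover have "beta lam r ` ({1..r} - {a}) = betas lam r - {x}"
    using inj_on_image_set_diff[OF inj_on_beta[OF pl, of r], of "{1..r}" "{a}"] abr
    by (simp add: betas_def x_def)
  moreover have "beta mu r ` ({1..r} - {b}) = betas mu r - {y}"
    using inj_on_image_set_diff[OF inj_on_beta[OF pm, of r], of "{1..r}" "{b}"] abr
    by (simp add: betas_def y_def)
  ultimately have eq: "betas mu r - {y} = betas lam r - {x}" by simp
  have xin: "x \<in> betas lam r" and yin: "y \<in> betas mu r" using abr by (auto simp: betas_def x_def y_def)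
  \<comment> \<open>The two bead sets differ only in \<open>x\<close> and \<open>y\<close>, so
    \<open>x - y\<close> is the difference of their sums, that is, of the diagram sizes.\<close>
  have "card (diagram lam) = card (diagram mu) + m"
    using R(2,4) Rlam finite_diagram[of lam] card_mono[of "diagram lam" R]
    by (simp add: card_Diff_subset finite_subset)
  then have "\<Sum>(betas lam r) = \<Sum>(betas mu r) + m"
    using sum_betas[OF pl len] sum_betas[OF pm, of r] lenm len by simp
  moreover have "\<Sum>(betas lam r) = x + \<Sum>(betas lam r - {x})" "\<Sum>(betas mu r) = y + \<Sum>(betas mu r - {y})"
    using xin yin by (auto simp: sum.remove)
  ultimately have "x = y + m" using eq by simp
  moreover have "y \<notin> betas lam r - {x}" using eq by blast
  moreover have "betas mu r = insert y (betas lam r - {x})" using eq yin by blast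
  ultimately show "\<exists>y. y + m \<in> betas lam r \<and> y \<notin> betas lam r - {y + m} \<and>
             betas mu r = insert y (betas lam r - {y + m})"
    using xin by blast
qed

text \<open>The bead of row \<open>a\<close> passes the beads of rows \<open>a + 1\<close> to
  \<open>b\<close>, which lie between \<open>y\<close> and \<open>y + m\<close>. Rows
  \<open>a\<close> to \<open>b - 1\<close> therefore inherit the next part reduced by one, row
  \<open>b\<close> gets the part with beta number \<open>y\<close>, and the cells lost form a rim
  hook.\<close>

lemma bead_move_rim_hook:
  assumes pl: "is_partition lam" and len: "length lam \<le> r" and m: "0 < m"
    and x: "y + m \<in> betas lam r" and y: "y \<notin> betas lam r"
  shows "\<exists>mu. removes_rim_hook m lam mu"
proof -
  define L where "L = part lam"
  obtain a where a: "a \<in> {1..r}" "beta lam r a = y + m" using x by (auto simp: betas_def)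
  define B where "B = {i \<in> {1..r}. y < beta lam r i}"
  define b where "b = Max B"
  have "a \<in> B" "finite B" using a m by (auto simp: B_def)
  then have bB: "b \<in> B" and ab: "a \<le> b" and bmax: "\<And>i. i \<in> B \<Longrightarrow> i \<le> b"
    using Max_in[of B] Max_ge[of B] unfolding b_def by blast+
  have br: "1 \<le> b" "b \<le> r" and yb: "y < L b + r - b" using bB by (auto simp: B_def beta_def L_def)
  have a1: "1 \<le> a" using a by simp
  have Lz: "L i = 0" if "r < i" for i using that len by (simp add: L_def part_def)
  have anti: "L j \<le> L i" if "1 \<le> i" "i \<le> j" for i j
    using part_antimono[OF pl that] by (simp add: L_def)
  \<comment> \<open>The bead of row \<open>b + 1\<close>, if there is one, is strictly below the
    free position \<open>y\<close>. In this form the bound also shows that \<open>y + b - r\<close>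
    in \<open>f\<close> is not truncated.\<close>
  have next_le: "L (b + 1) + r \<le> y + b"
  proof (cases "b < r")
    case True
    then have "b + 1 \<in> {1..r}" "b + 1 \<notin> B" using bmax[of "b + 1"] by auto
    moreover from this have "beta lam r (b + 1) \<noteq> y" using y by (auto simp: betas_def)
    ultimately have "beta lam r (b + 1) < y" by (auto simp: B_def)
    then show ?thesis using True by (simp add: beta_def L_def)
  next
    case False
    then show ?thesis using br Lz[of "b + 1"] by simp
  qed
  define f where "f i = (if i < a \<or> b < i then L i else if i < b then L (i + 1) - 1 else y + b - r)" for i
  have pos: "1 \<le> L i" if "1 \<le> i" "i \<le> b" for i
    using anti[OF that] yb br next_le by linarith
  have f_less: "f i < L i" if "a \<le> i" "i \<le> b" for i
    using that a1 pos[of i] anti[of i "i + 1"] yb br next_le by (auto simp: f_def)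
  have f_ge: "L (i + 1) \<le> f i + 1" if "a \<le> i" "i \<le> b" for i
    using that next_le by (auto simp: f_def)
  have f_out: "f i = L i" if "\<not> (a \<le> i \<and> i \<le> b)" for i
    using that by (auto simp: f_def)
  have f_step: "f (i + 1) \<le> f i" if "1 \<le> i" for i
  proof -
    consider "i < a" | "a \<le> i" "i < b" | "i = b" "a \<le> i" | "b < i" by linarith
    then show ?thesis
    proof cases
      case 1
      then have "f i = L i" by (simp add: f_out)
      moreover have "f (i + 1) \<le> L (i + 1)" using f_less[of "i + 1"] f_out[of "i + 1"] by linarith
      ultimately show ?thesis using anti[of i "i + 1"] that by simp
    next
      case 2
      then show ?thesis using f_less[of "i + 1"] by (auto simp: f_def)
    next
      case 3
      then show ?thesis using next_le by (auto simp: f_def)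
    next
      case 4
      then show ?thesis using anti[of i "i + 1"] that f_out[of i] f_out[of "i + 1"] by simp
    qed
  qed
  have f_anti: "f j \<le> f i" if "1 \<le> i" "i \<le> j" for i j
    using that(2,1)
  proof (induction j rule: dec_induct)
    case (step n)
    then show ?case using f_step[of n] by simp
  qed simp
  have "f i = 0" if "r < i" for i
    using that br Lz[of i] by (simp add: f_def)
  from exists_partition[of f r, OF f_anti this]
  obtain mu where pm: "is_partition mu" and mu: "\<And>i. 1 \<le> i \<Longrightarrow> part mu i = f i" by blast
  define R where "R = (SIGMA i:{a..b}. {f i<..L i})"
  have R_diff: "R = diagram lam - diagram mu"
    using a1 f_out mu by (fastforce simp: R_def diagram_def L_def)
  have mu_sub: "diagram mu \<subseteq> diagram lam"
  proof -
    have "f i \<le> L i" for i using f_less[of i] f_out[of i] by linarith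
    then show ?thesis using mu by (auto simp: diagram_def L_def intro: order_trans)
  qed
  have "R \<subseteq> rim lam"
  proof
    fix p assume "p \<in> R"
    then obtain i j where p: "p = (i, j)" "a \<le> i" "i \<le> b" "f i < j" "j \<le> L i" by (auto simp: R_def)
    then have "L (i + 1) < j + 1" using f_ge[of i] by linarith
    moreover have "p \<in> diagram lam" using \<open>p \<in> R\<close> R_diff by simp
    ultimately show "p \<in> rim lam" by (simp add: rim_def p(1) diagram_def L_def)
  qed
  moreover have "card R = m"
  proof -
    \<comment> \<open>With \<open>g\<close> the row sums telescope: row \<open>i < b\<close> loses
      \<open>L i - L (i + 1) + 1 = g i - g (i + 1)\<close> cells. Adding the last row leaves
      \<open>L a - a + r - y\<close>, which is \<open>m\<close> since row \<open>a\<close> has beta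
      number \<open>y + m\<close>.\<close>
    define g where "g i = int (L i) - int i" for i
    have "int (card R) = (\<Sum>i=a..b. int (L i) - int (f i))"
      using f_less by (simp add: R_def less_imp_le of_nat_diff)
    also have "{a..b} = insert b {a..<b}" using ab by auto
    also have "(\<Sum>i\<in>insert b {a..<b}. int (L i) - int (f i)) =
        int (L b) - int (f b) + (\<Sum>i=a..<b. int (L i) - int (f i))" by simp
    also have "(\<Sum>i=a..<b. int (L i) - int (f i)) = (\<Sum>i=a..<b. - (g (Suc i) - g i))"
      using pos a1 by (intro sum.cong) (auto simp: f_def g_def of_nat_diff)
    also have "\<dots> = - (g b - g a)"
      by (simp only: sum_negf sum_Suc_diff'[OF ab])
    also have "int (L b) - int (f b) + - (g b - g a) = int m"
      using a next_le ab br by (auto simp: f_def g_def beta_def L_def of_nat_diff)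
    finally show ?thesis by simp
  qed
  moreover have "connected_cells R"
  proof -
    define E where "E = {(u, v). u \<in> R \<and> v \<in> R \<and> adjacent u v}"
    have "sym E" by (auto simp: sym_def E_def adjacent_def)
    \<comment> \<open>Every cell is joined to \<open>(a, L a)\<close>: go right to the end of the
      row, one cell up, and repeat. The cell above \<open>(n + 1, L (n + 1))\<close> lies in
      \<open>R\<close> because \<open>f n = L (n + 1) - 1\<close>.\<close>
    have row: "((i, j), (i, L i)) \<in> E\<^sup>*" if "a \<le> i" "i \<le> b" "f i < j" "j \<le> L i" for i j
      using that(4,3)
    proof (induction j rule: inc_induct)
      case (step n)
      then have "((i, n), (i, Suc n)) \<in> E" using that by (auto simp: E_def R_def adjacent_def)
      then show ?case using step by (meson converse_rtrancl_into_rtrancl less_SucI)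
    qed simp
    have col: "((i, L i), (a, L a)) \<in> E\<^sup>*" if "a \<le> i" "i \<le> b" for i
      using that
    proof (induction i rule: dec_induct)
      case (step n)
      have "f n < L (Suc n)" "L (Suc n) \<le> L n"
        using step pos[of "Suc n"] anti[of n "Suc n"] a1 by (auto simp: f_def)
      then have "((Suc n, L (Suc n)), (n, L (Suc n))) \<in> E" "((n, L (Suc n)), (n, L n)) \<in> E\<^sup>*"
        using step f_less[of "Suc n"] row[of n "L (Suc n)"] by (auto simp: E_def R_def adjacent_def)
      then show ?case using step by (meson Suc_leD converse_rtrancl_into_rtrancl rtrancl_trans)
    qed simp
    have root: "(u, (a, L a)) \<in> E\<^sup>*" if "u \<in> R" for u
    proof -
      obtain i j where "u = (i, j)" "a \<le> i" "i \<le> b" "f i < j" "j \<le> L i"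
        using \<open>u \<in> R\<close> by (auto simp: R_def)
      then show ?thesis using rtrancl_trans[OF row[of i j] col[of i]] by simp
    qed
    have "(u, v) \<in> E\<^sup>*" if "u \<in> R" "v \<in> R" for u v
      using root[OF that(1)] symD[OF sym_rtrancl[OF \<open>sym E\<close>] root[OF that(2)]]
      by (rule rtrancl_trans)
    then show ?thesis unfolding connected_cells_def E_def by blast
  qed
  moreover have "diagram mu = diagram lam - R" using R_diff mu_sub by auto
  ultimately show ?thesis using pl pm unfolding removes_rim_hook_def by blast
qed

subsection \<open>Flush bead configurations and the core\<close>

text \<open>No bead of the \<open>m\<close>-abacus can be moved down: on every runner the beads fill
  the lowest positions. The notion is used with both moduli, \<open>m\<close> and
  \<open>k\<close>.\<close>

definition flush :: "nat \<Rightarrow> nat set \<Rightarrow> bool" where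
  "flush m P \<longleftrightarrow> (\<forall>x\<in>P. m \<le> x \<longrightarrow> x - m \<in> P)"

abbreviation runner :: "nat \<Rightarrow> nat set \<Rightarrow> nat \<Rightarrow> nat set" where
  "runner m P c \<equiv> {z \<in> P. z mod m = c}"

lemma down_closed_eq_lessThan:
  fixes T :: "nat set"
  assumes "finite T" "\<And>s. Suc s \<in> T \<Longrightarrow> s \<in> T"
  shows "T = {..<card T}"
proof -
  have "\<exists>n. n \<notin> T" using assms(1) ex_new_if_finite infinite_UNIV_nat by blast
  define n where "n = (LEAST n. n \<notin> T)"
  have n: "n \<notin> T" unfolding n_def using \<open>\<exists>n. n \<notin> T\<close> by (rule LeastI_ex)
  have below: "i \<in> T" if "i < n" for i using not_less_Least that unfolding n_def by blast
  have "i \<notin> T" if "n \<le> i" for i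
    using that by (induction i rule: dec_induct) (use n assms(2) in auto)
  then have "T = {..<n}" using below by (meson lessThan_iff not_less subsetI subset_antisym)
  then show ?thesis by simp
qed

text \<open>A bead forces all lower positions on its runner to be occupied, so the heights form an
  initial segment and a flush set is determined by its runner counts.\<close>

lemma flush_mem_iff:
  assumes "finite P" "flush m P" "c < m"
  shows "c + m * s \<in> P \<longleftrightarrow> s < card (runner m P c)"
proof -
  define T where "T = {s. c + m * s \<in> P}"
  have inj: "inj (\<lambda>s. c + m * s)" using assms(3) by (intro injI) auto
  have img: "runner m P c = (\<lambda>s. c + m * s) ` T"
  proof (intro equalityI subsetI)
    fix z assume z: "z \<in> runner m P c"
    then have eq: "c + m * (z div m) = z" by auto
    then have "z div m \<in> T" using z by (simp add: T_def)
    then show "z \<in> (\<lambda>s. c + m * s) ` T" by (rule image_eqI[rotated]) (simp add: eq)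
  next
    fix z assume "z \<in> (\<lambda>s. c + m * s) ` T"
    then show "z \<in> runner m P c" using assms(3) by (auto simp: T_def)
  qed
  have "finite (runner m P c)" using assms(1) by simp
  then have "finite T"
    unfolding img by (rule finite_imageD) (rule inj_on_subset[OF inj], simp)
  moreover have "s \<in> T" if "Suc s \<in> T" for s
    using that assms(2) unfolding T_def flush_def by fastforce
  ultimately have "T = {..<card T}" by (rule down_closed_eq_lessThan)
  moreover have "card (runner m P c) = card T"
    unfolding img by (rule card_image[OF inj_on_subset[OF inj]]) simp
  ultimately show ?thesis by (auto simp: T_def)
qed

lemma flush_eqI:
  assumes "finite P" "flush m P" "finite Q" "flush m Q" "0 < m"
    and "\<And>c. c < m \<Longrightarrow> card (runner m P c) = card (runner m Q c)"
  shows "P = Q"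
proof -
  have "z \<in> P \<longleftrightarrow> z \<in> Q" for z
    using flush_mem_iff[OF assms(1,2), of "z mod m" "z div m"]
      flush_mem_iff[OF assms(3,4), of "z mod m" "z div m"] assms(5,6) by simp
  then show ?thesis by blast
qed

lemma card_runner_bead_move:
  assumes "finite S" "y + m \<in> S" "y \<notin> S - {y + m}"
  shows "card (runner m (insert y (S - {y + m})) c) = card (runner m S c)"
proof (cases "y mod m = c")
  case True
  then have "runner m (insert y (S - {y + m})) c = insert y (runner m S c - {y + m})" by auto
  then show ?thesis using assms True by (simp add: card_Suc_Diff1 del: card_Diff_insert)
next
  case False
  then have "runner m (insert y (S - {y + m})) c = runner m S c" by auto
  then show ?thesis by simp
qed

text \<open>Hook removals preserve runner counts, and a partition without removable hook has a flush
  bead set, which the counts determine. Hence the irreducible partition reached from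
  \<open>lam\<close> is unique, \<open>core\<close> is well defined, and \<open>P\<close> is
  recognised by being flush with the right counts.\<close>

lemma core_betas:
  assumes m: "0 < m" and lam: "is_partition lam" "length lam \<le> r"
    and P: "finite P" "flush m P"
    and cnt: "\<And>c. c < m \<Longrightarrow> card (runner m P c) = card (runner m (betas lam r) c)"
  shows "is_partition (core m lam) \<and> length (core m lam) \<le> r \<and> betas (core m lam) r = P"
proof -
  define nf where "nf mu \<longleftrightarrow> (removes_rim_hook m)\<^sup>*\<^sup>* lam mu \<and> (\<nexists>nu. removes_rim_hook m mu nu)" for mu
  have inv: "is_partition mu \<and> length mu \<le> r \<and>
      (\<forall>c. card (runner m (betas mu r) c) = card (runner m (betas lam r) c))"
    if "(removes_rim_hook m)\<^sup>*\<^sup>* lam mu" for mu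
    using that
  proof (induction rule: rtranclp_induct)
    case base
    show ?case using lam by simp
  next
    case (step mu nu)
    then have len: "length mu \<le> r" and pn: "is_partition nu" by (auto simp: removes_rim_hook_def)
    from rim_hook_bead_move(2)[OF step(2) m len] obtain y
      where "y + m \<in> betas mu r" "y \<notin> betas mu r - {y + m}"
        "betas nu r = insert y (betas mu r - {y + m})" by blast
    then have "card (runner m (betas nu r) c) = card (runner m (betas mu r) c)" for c
      using card_runner_bead_move[of "betas mu r" y m c] by simp
    then show ?case using step.IH pn rim_hook_bead_move(1)[OF step(2) m len] by simp
  qed
  have nf_betas: "is_partition mu \<and> length mu \<le> r \<and> betas mu r = P" if "nf mu" for mu
  proof -
    have mu: "is_partition mu" "length mu \<le> r"
      "\<And>c. card (runner m (betas mu r) c) = card (runner m (betas lam r) c)"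
      using inv[of mu] that by (auto simp: nf_def)
    have "flush m (betas mu r)"
      unfolding flush_def
    proof (intro ballI impI)
      fix x assume "x \<in> betas mu r" "m \<le> x"
      then show "x - m \<in> betas mu r"
        using bead_move_rim_hook[OF mu(1,2) m, of "x - m"] that by (auto simp: nf_def)
    qed
    then have "betas mu r = P"
      using flush_eqI[of "betas mu r" m P] P m cnt mu(3) by simp
    then show ?thesis using mu by simp
  qed
  \<comment> \<open>Existence: every removal shrinks the diagram because
    \<open>m > 0\<close>.\<close>
  have "\<exists>mu. (removes_rim_hook m)\<^sup>*\<^sup>* kap mu \<and> (\<nexists>nu. removes_rim_hook m mu nu)" for kap
  proof (induction "card (diagram kap)" arbitrary: kap rule: less_induct)
    case less
    show ?case
    proof (cases "\<exists>nu. removes_rim_hook m kap nu")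
      case True
      then obtain nu where nu: "removes_rim_hook m kap nu" by blast
      then obtain R where "R \<subseteq> rim kap" "card R = m" "diagram nu = diagram kap - R"
        unfolding removes_rim_hook_def by blast
      moreover have "rim kap \<subseteq> diagram kap" by (auto simp: rim_def)
      moreover have "R \<noteq> {}" using \<open>card R = m\<close> m by auto
      ultimately have "diagram nu \<subset> diagram kap" by blast
      then have "card (diagram nu) < card (diagram kap)"
        by (rule psubset_card_mono[OF finite_diagram])
      then show ?thesis using less nu by (meson converse_rtranclp_into_rtranclp)
    qed blast
  qed
  then obtain mu where "nf mu" unfolding nf_def by blast
  moreover have "nu = mu" if "nf nu" for nu
    using nf_betas[OF that] nf_betas[OF \<open>nf mu\<close>] betas_eqD[of nu mu r] by simp
  ultimately have "core m lam = mu"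
    unfolding core_def nf_def by (rule the_equality)
  then show ?thesis using nf_betas[OF \<open>nf mu\<close>] by simp
qed

subsection \<open>Runner counts of the initial residues\<close>

locale wh_params =
  fixes m k l :: int
  assumes m_pos: "0 < m" and l_nonneg: "0 \<le> l" and l_less: "l < k" and k_ndvd: "\<not> k dvd m"
begin

definition "d = gcd m k"
definition "mh = m div d"
definition "kh = k div d"
definition "m1 = m div k"
definition "m0 = m mod k"
text \<open>For \<open>t \<ge> 0\<close>, the number of steps of length \<open>m0\<close> that can
  be taken to the left from \<open>l + t * k\<close> without becoming negative.\<close>

definition "q t = (l + t * k) div m0"

text \<open>Times at which the walk \<open>(l + i * k) mod m\<close> stands on runner
  \<open>x\<close> of the \<open>k\<close>-abacus; for \<open>n = N mod mh\<close> their number will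
  be identified with \<open>Nhat\<close>.\<close>

definition J :: "int \<Rightarrow> int \<Rightarrow> int set" where
  "J n x = {i \<in> {0..<n}. (l + i * k) mod m mod k = x}"

lemma k_pos: "0 < k" using l_nonneg l_less by linarith

lemma d_pos: "0 < d" using m_pos by (simp add: d_def)

lemma m_eq_d: "m = d * mh" by (simp add: mh_def d_def)

lemma k_eq_d: "k = d * kh" by (simp add: kh_def d_def)

lemma m_eq: "m = m1 * k + m0" by (simp add: m1_def m0_def)

lemma m0_less: "m0 < k" using k_pos by (simp add: m0_def)

lemma m0_pos: "0 < m0"
  using k_pos k_ndvd by (simp add: m0_def dvd_eq_mod_eq_0 order_less_le)

lemma m1_nonneg: "0 \<le> m1" using m_pos k_pos by (simp add: m1_def pos_imp_zdiv_nonneg_iff)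

lemma mh_pos: "0 < mh" using m_pos d_pos m_eq_d zero_less_mult_pos[of d mh] by simp

lemma coprime_mh_kh: "coprime mh kh"
  unfolding mh_def kh_def d_def using m_pos by (intro div_gcd_coprime) auto

text \<open>Dividing by \<open>d\<close> leaves \<open>mh dvd kh * (i - j)\<close>, and
  \<open>kh\<close> is prime to \<open>mh\<close>: the walk has exact period
  \<open>mh\<close>.\<close>

lemma mod_m_eq_iff: "(l + i * k) mod m = (l + j * k) mod m \<longleftrightarrow> mh dvd i - j"
proof -
  have "(l + i * k) mod m = (l + j * k) mod m \<longleftrightarrow> m dvd (i - j) * k"
    by (simp add: mod_eq_dvd_iff algebra_simps)
  also have "\<dots> \<longleftrightarrow> d * mh dvd d * (kh * (i - j))"
    using m_eq_d k_eq_d by (metis mult.assoc mult.commute)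
  also have "\<dots> \<longleftrightarrow> mh dvd kh * (i - j)" using d_pos by simp
  also have "\<dots> \<longleftrightarrow> mh dvd i - j"
    using coprime_mh_kh by (simp add: coprime_dvd_mult_right_iff)
  finally show ?thesis .
qed

section \<open>The quotients \<open>q t\<close> and the visits of the walk to a runner\<close>

lemma q_div: "l + t * k = q t * m0 + (l + t * k) mod m0" "0 \<le> (l + t * k) mod m0" "(l + t * k) mod m0 < m0"
  unfolding q_def using m0_pos by (simp_all only: div_mult_mod_eq pos_mod_sign pos_mod_bound)

lemma q_mono: "s \<le> t \<Longrightarrow> q s \<le> q t"
  unfolding q_def using m0_pos k_pos by (intro zdiv_mono1) auto

lemma q_nonneg: "0 \<le> t \<Longrightarrow> 0 \<le> q t"
  unfolding q_def using m0_pos k_pos l_nonneg by (simp add: pos_imp_zdiv_nonneg_iff)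

lemma le_q_iff: "n \<le> q t \<longleftrightarrow> n * m0 \<le> l + t * k"
proof
  assume "n \<le> q t"
  then have "n * m0 \<le> q t * m0" using m0_pos by (intro mult_right_mono) auto
  then show "n * m0 \<le> l + t * k" using q_div[of t] by linarith
next
  assume le: "n * m0 \<le> l + t * k"
  have "n = n * m0 div m0" using m0_pos by simp
  also have "\<dots> \<le> q t" unfolding q_def using le m0_pos by (rule zdiv_mono1)
  finally show "n \<le> q t" .
qed

text \<open>Since \<open>x\<close> is a runner, \<open>t\<close> is the least index for which
  \<open>l + t * k\<close> admits \<open>n\<close> steps to the left. The runner lies below
  \<open>m0\<close> exactly when no further step is possible; it then has \<open>m1 + 1\<close>
  positions below \<open>m\<close>, and otherwise \<open>m1\<close>.\<close>

lemma q_range: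
  assumes x: "x = l + t * k - n * m0" "0 \<le> x" "x < k"
  shows "n \<le> q t" and "q (t - 1) < n" and "x < m0 \<longleftrightarrow> n = q t"
proof -
  show *: "n \<le> q t" using x by (simp add: le_q_iff)
  have "l + (t - 1) * k < n * m0" using x by (simp add: algebra_simps)
  then show "q (t - 1) < n" using le_q_iff[of n "t - 1"] by linarith
  have "x < m0 \<longleftrightarrow> l + t * k < (n + 1) * m0" using x by (auto simp: algebra_simps)
  also have "\<dots> \<longleftrightarrow> q t < n + 1" using le_q_iff[of "n + 1" t] by linarith
  finally show "x < m0 \<longleftrightarrow> n = q t" using * by linarith
qed

text \<open>The residues \<open>(l + i * k) mod m\<close> run up a runner until they leave \<open>{0..<m}\<close>; subtracting \<open>m\<close> then
  leads to the bottom of the runner \<open>m0\<close> to the left (cyclically). After \<open>n\<close> such wraps the bottom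
  of runner \<open>x = l + t * k - n * m0\<close> is reached at time \<open>i = n * m1 + t\<close>.\<close>

lemma card_J:
  assumes x: "x = l + t * k - n * m0" "0 \<le> x" "x < k"
    and start: "0 \<le> n" "0 \<le> t" "n * m1 + t < mh" and N0: "N0 \<le> mh"
  shows "int (card (J N0 x)) = max 0 (min (N0 - (n * m1 + t)) (m1 + (if x < m0 then 1 else 0)))"
proof -
  define i0 len where "i0 = n * m1 + t" and "len = m1 + (if x < m0 then 1 else 0)"
  have i0: "0 \<le> i0" using start m1_nonneg by (simp add: i0_def)
  have eq: "l + (i0 + s) * k = x + s * k + n * m" for s
    unfolding i0_def x(1) by (subst m_eq) (simp add: algebra_simps)
  have bound: "x + s * k < m" if "s < len" for s
  proof (cases "x < m0")
    case True
    then have "s * k \<le> m1 * k" using that k_pos by (intro mult_right_mono) (auto simp: len_def)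
    then show ?thesis using True m_eq by linarith
  next
    case False
    then have "(s + 1) * k \<le> m1 * k" using that k_pos by (intro mult_right_mono) (auto simp: len_def)
    then show ?thesis using x(3) m_eq m0_pos by (simp add: algebra_simps)
  qed
  have val: "(l + (i0 + s) * k) mod m = x + s * k" if "0 \<le> s" "s < len" for s
  proof -
    have "0 \<le> x + s * k" using that x k_pos by simp
    then show ?thesis unfolding eq using bound[OF that(2)] by simp
  qed
  have no_wrap: "i0 + s < mh" if "0 \<le> s" "s < len" for s
  proof (rule ccontr)
    assume "\<not> i0 + s < mh"
    then have s': "1 \<le> mh - i0" "mh - i0 < len" using that start by (auto simp: i0_def)
    then have "(l + mh * k) mod m = x + (mh - i0) * k" using val[of "mh - i0"] by simp
    moreover have "(l + mh * k) mod m = l mod m" using mod_m_eq_iff[of mh 0] by simp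
    moreover have "l mod m \<le> l" using l_nonneg m_pos by (simp add: zmod_le_nonneg_dividend)
    moreover have "1 * k \<le> (mh - i0) * k" using s' k_pos by (intro mult_right_mono) auto
    ultimately show False using l_less x by linarith
  qed
  \<comment> \<open>The run on runner \<open>x\<close> ends within one period: at time
    \<open>mh\<close> the walk is back at \<open>l mod m < k\<close>, whereas a run still going on
    would stand at height at least 1, hence at a position \<open>\<ge> k\<close>.\<close>
  have "J N0 x = {i0..<min N0 (i0 + len)}"
  proof (intro equalityI subsetI)
    fix i assume "i \<in> {i0..<min N0 (i0 + len)}"
    then show "i \<in> J N0 x" using val[of "i - i0"] i0 x by (auto simp: J_def)
  next
    \<comment> \<open>The walk also meets the position \<open>a\<close> at time
      \<open>i0 + s\<close>, and two times below \<open>mh\<close> with the same position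
      agree.\<close>
    fix i assume "i \<in> J N0 x"
    then have i: "0 \<le> i" "i < N0" "(l + i * k) mod m mod k = x" by (auto simp: J_def)
    define a s where "a = (l + i * k) mod m" and "s = a div k"
    have a: "0 \<le> a" "a < m" using m_pos by (auto simp: a_def)
    have a_eq: "a = s * k + x" using i(3) unfolding s_def a_def by (metis div_mult_mod_eq)
    have s0: "0 \<le> s" using a k_pos by (simp add: s_def pos_imp_zdiv_nonneg_iff)
    have "s < len"
    proof (rule ccontr)
      assume "\<not> s < len"
      then have "len * k \<le> s * k" using k_pos by (intro mult_right_mono) auto
      moreover have "m \<le> len * k + x"
        using m_eq m0_less x(2) by (auto simp: len_def algebra_simps)
      ultimately show False using a(2) a_eq by linarith
    qed
    have "(l + (i0 + s) * k) mod m = (l + i * k) mod m"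
      using val[OF s0 \<open>s < len\<close>] a_eq by (simp add: a_def)
    then have "mh dvd i0 + s - i" by (simp add: mod_m_eq_iff)
    moreover have "\<bar>i0 + s - i\<bar> < mh" using no_wrap[OF s0 \<open>s < len\<close>] i N0 i0 s0 by linarith
    ultimately have "i0 + s - i = 0" using zdvd_imp_le[of mh "\<bar>i0 + s - i\<bar>"] by force
    then show "i \<in> {i0..<min N0 (i0 + len)}" using i s0 \<open>s < len\<close> by auto
  qed
  then show ?thesis by (auto simp: i0_def len_def)
qed

text \<open>At time \<open>i\<close>, after \<open>n\<close> wraps, the walk is \<open>s\<close>
  steps above the bottom of runner \<open>x\<close>, so the bottom belongs to time
  \<open>i - s\<close>, and \<open>t\<close> is \<open>i - s - n * m1\<close>. It is nonnegative
  because \<open>x \<ge> 0\<close> and \<open>l < k\<close>.\<close>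

lemma J_origin:
  assumes i: "i \<in> J N0 x" and x: "0 \<le> x"
  obtains n t where "0 \<le> n" "0 \<le> t" "x = l + t * k - n * m0" "n * m1 + t < N0"
proof -
  have i: "0 \<le> i" "i < N0" "(l + i * k) mod m mod k = x" using i by (auto simp: J_def)
  define a n s where "a = (l + i * k) mod m" and "n = (l + i * k) div m" and "s = a div k"
  have n: "0 \<le> n" using i l_nonneg k_pos m_pos by (simp add: n_def pos_imp_zdiv_nonneg_iff)
  have s: "0 \<le> s" using k_pos m_pos by (simp add: s_def a_def pos_imp_zdiv_nonneg_iff)
  have "a = s * k + x" using i(3) unfolding s_def a_def by (metis div_mult_mod_eq)
  moreover have "l + i * k = n * m + a" unfolding n_def a_def by simp
  ultimately have "l + i * k = n * (m1 * k + m0) + s * k + x" using m_eq by simp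
  then have x_eq: "x = l + (i - s - n * m1) * k - n * m0" by (simp add: algebra_simps)
  have "0 \<le> n * m0" using n m0_pos by simp
  then have "0 < k + (i - s - n * m1) * k" using x_eq x l_less by linarith
  then have "0 < (i - s - n * m1 + 1) * k" by (simp add: algebra_simps)
  then have "0 \<le> i - s - n * m1" using k_pos by (simp add: zero_less_mult_iff)
  then show ?thesis using that[OF n _ x_eq] i(2) s by simp
qed

lemma m0_div_d: "m0 = d * (m0 div d)" "mh = kh * m1 + m0 div d" "0 < m0 div d"
proof -
  have "d dvd m0" by (simp add: m0_def d_def dvd_mod)
  then show m0: "m0 = d * (m0 div d)" by simp
  have "d * mh = d * (kh * m1 + m0 div d)"
    using m_eq m_eq_d k_eq_d m0 by (metis mult.assoc mult.commute distrib_left)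
  then show "mh = kh * m1 + m0 div d" using d_pos by simp
  show "0 < m0 div d" using m0 m0_pos d_pos zero_less_mult_pos[of d "m0 div d"] by simp
qed

text \<open>\<open>m0 div d\<close> steps of length \<open>k\<close> cover the same distance as
  \<open>kh\<close> steps of length \<open>m0\<close>. This places the last threshold for
  \<open>r\<close> beyond \<open>mh\<close>.\<close>

lemma q_period: "q (m0 div d) = q 0 + kh"
proof -
  have "(m0 div d) * k = m0 * kh" using m0_div_d(1) k_eq_d by (metis mult.assoc mult.commute)
  then show ?thesis using m0_pos by (simp add: q_def)
qed

text \<open>The thresholds increase with \<open>r\<close>, the first is at most \<open>N0\<close>,
  and by \<open>q_period\<close> the one at \<open>m0 div d + 1\<close> is the first plus
  \<open>mh\<close>, hence above \<open>N0\<close>. So exactly one \<open>r\<close> qualifies and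
  the definite description is meaningful.\<close>

lemma proc_r_spec:
  assumes N0: "N0 = N mod mh" and large: "q 0 * m1 + m1 + 1 \<le> N0"
  defines "r \<equiv> proc_r m k l N"
  shows "1 \<le> r" "q (r - 1) * m1 + m1 + r \<le> N0" "N0 < q r * m1 + m1 + r + 1"
proof -
  \<comment> \<open>The \<open>r\<close>-th runner below \<open>m0\<close> is entered at time
    \<open>q (r - 1) * m1 + r - 1\<close> and has \<open>m1 + 1\<close> positions, so
    \<open>G r\<close> is the time at which it is full.\<close>
  define G where "G r = q (r - 1) * m1 + m1 + r" for r
  define S where "S = {r \<in> {1..m0 div d}. G r \<le> N0}"
  define R where "R r \<longleftrightarrow> 1 \<le> r \<and> r \<le> m0 div d \<and> G r \<le> N0 \<and> N0 < G (r + 1)" for r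
  have G_mono: "G s \<le> G t" if "s \<le> t" for s t
    using mult_right_mono[OF q_mono[of "s - 1" "t - 1"] m1_nonneg] that by (simp add: G_def)
  have "G (m0 div d + 1) = (q 0 + kh) * m1 + m1 + (m0 div d + 1)"
    by (simp add: G_def q_period)
  also have "\<dots> = q 0 * m1 + m1 + 1 + mh" using m0_div_d(2) by (simp add: algebra_simps)
  finally have top: "N0 < G (m0 div d + 1)"
    using N0 mh_pos q_nonneg[of 0] m1_nonneg by (simp add: add_pos_nonneg add_strict_increasing2)
  have "1 \<le> m0 div d" "G 1 \<le> N0" using large m0_div_d(3) by (linarith, simp add: G_def)
  then have "1 \<in> S" by (simp only: S_def mem_Collect_eq atLeastAtMost_iff order_refl)
  moreover have "finite S" unfolding S_def by (rule finite_subset[of _ "{1..m0 div d}"]) auto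
  ultimately have max: "Max S \<in> S" "\<And>s. s \<in> S \<Longrightarrow> s \<le> Max S" using Max_in Max_ge by blast+
  have "R (Max S)"
  proof (cases "Max S = m0 div d")
    case True
    then show ?thesis using max(1) top by (auto simp: R_def S_def)
  next
    case False
    then have "Max S + 1 \<in> {1..m0 div d}" using max(1) by (auto simp: S_def)
    moreover have "Max S + 1 \<notin> S" using max(2)[of "Max S + 1"] by auto
    ultimately show ?thesis using max(1) by (auto simp: R_def S_def)
  qed
  moreover have "s = t" if "R s" "R t" for s t
    using that G_mono[of "s + 1" t] G_mono[of "t + 1" s] by (cases s t rule: linorder_cases) (auto simp: R_def)
  ultimately have "R (THE r. R r)" by (metis theI)
  moreover have "r = (THE r. R r)"
    unfolding r_def proc_r_def Let_def R_def G_def N0 mh_def[symmetric] d_def[symmetric]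
      m0_def[symmetric] m1_def[symmetric] q_def[symmetric]
    by (simp only: add_diff_cancel_right' add.assoc)
  ultimately have "R r" by simp
  then show "1 \<le> r" "q (r - 1) * m1 + m1 + r \<le> N0" "N0 < q r * m1 + m1 + r + 1"
    by (auto simp: R_def G_def)
qed

section \<open>Comparison of \<open>Nhat\<close> with the visits of the walk\<close>

lemma Nhat_unfold:
  "Nhat m k l N x =
     (let N0 = N mod mh in
      if N0 < q 0 * m1 + m1 + 1 then
        (if m1 \<noteq> 0 then
           (if \<exists>j\<in>{1..N0 div m1}. x = l - (j - 1) * m0 then m1
            else if x = l - (N0 div m1) * m0 then N0 mod m1
            else 0)
         else 0)
      else
        (let r = proc_r m k l N in
         if m1 \<noteq> 0 then
           (if \<exists>j\<in>{1..r}. x = (l + (j - 1) * k) mod m0 then m1 + 1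
            else if (\<exists>j\<in>{1..q 0}. x = l - (j - 1) * m0) \<or>
                    (\<exists>t\<in>{1..r - 1}. \<exists>j\<in>{q (t - 1) + 1<..q t}. x = l + t * k - (j - 1) * m0) \<or>
                    (\<exists>j\<in>{q (r - 1) + 1<..(N0 - r) div m1}. x = l + r * k - (j - 1) * m0)
            then m1
            else if x = l + r * k - ((N0 - r) div m1) * m0 then (N0 - r) mod m1
            else 0)
         else
           (if \<exists>j\<in>{1..N0}. x = (l + (j - 1) * k) mod m then 1 else 0)))"
  unfolding Nhat_def Let_def mh_def d_def m0_def m1_def q_def by simp

text \<open>Here \<open>m < k\<close>, so every position below \<open>m\<close> is alone on its
  runner, and within a period no position is met twice. Case I leaves only \<open>N0 = 0\<close>,
  where both sides vanish.\<close>

lemma Nhat_eq_card_J_m1_zero: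
  assumes "m1 = 0" "0 \<le> x" "x < k"
  shows "Nhat m k l N x = int (card (J (N mod mh) x))"
proof -
  define N0 where "N0 = N mod mh"
  have N0: "0 \<le> N0" "N0 < mh" using mh_pos by (auto simp: N0_def)
  have "m < k" using m_eq m0_less assms(1) by simp
  have J: "J N0 x = {i \<in> {0..<N0}. (l + i * k) mod m = x}"
  proof -
    have "(l + i * k) mod m mod k = (l + i * k) mod m" for i
      using \<open>m < k\<close> pos_mod_sign[OF m_pos, of "l + i * k"] pos_mod_bound[OF m_pos, of "l + i * k"]
      by (intro mod_pos_pos_trivial) linarith+
    then show ?thesis by (simp add: J_def)
  qed
  have "Nhat m k l N x = (if \<exists>j\<in>{1..N0}. x = (l + (j - 1) * k) mod m then 1 else 0)"
    using N0 assms(1) by (simp add: Nhat_unfold Let_def N0_def[symmetric])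
  also have "\<dots> = int (card (J N0 x))"
  proof (cases "\<exists>j\<in>{1..N0}. x = (l + (j - 1) * k) mod m")
    case True
    then obtain j where j: "j \<in> {1..N0}" "x = (l + (j - 1) * k) mod m" by blast
    have "i = j - 1" if "i \<in> J N0 x" for i
    proof -
      have i: "0 \<le> i" "i < N0" "(l + i * k) mod m = x" using that unfolding J by auto
      then have "mh dvd i - (j - 1)" using j(2) by (simp only: mod_m_eq_iff[symmetric])
      moreover have "\<bar>i - (j - 1)\<bar> < mh" using i j(1) N0 by auto
      ultimately show ?thesis using zdvd_imp_le[of mh "\<bar>i - (j - 1)\<bar>"] by force
    qed
    moreover have "j - 1 \<in> J N0 x" unfolding J using j by auto
    ultimately have "J N0 x = {j - 1}" by blast
    then show ?thesis using True by simp
  next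
    case False
    then have "(l + (i + 1 - 1) * k) mod m \<noteq> x" if "i \<in> {0..<N0}" for i
      using that by (metis atLeastAtMost_iff atLeastLessThan_iff le_add_same_cancel2 zless_imp_add1_zle)
    then have "J N0 x = {}" unfolding J by auto
    then show ?thesis using False by simp
  qed
  finally show ?thesis by (simp add: N0_def)
qed

text \<open>The bound says that the first runner below \<open>m0\<close>, namely
  \<open>l - q 0 * m0\<close>, has not received its last position. Hence only runners with
  \<open>t = 0\<close> are visited, and each takes \<open>m1\<close> positions before the next one
  starts.\<close>

lemma Nhat_eq_card_J_case_I:
  assumes m1: "m1 \<noteq> 0" and x: "0 \<le> x" "x < k" and N0: "N0 = N mod mh"
    and small: "N0 < q 0 * m1 + m1 + 1"
  shows "Nhat m k l N x = int (card (J N0 x))"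
proof -
  have m1_pos: "0 < m1" using m1 m1_nonneg by simp
  have N0b: "0 \<le> N0" "N0 < mh" using mh_pos by (auto simp: N0)
  define w v where "w = N0 div m1" and "v = N0 mod m1"
  have "N0 = w * m1 + v" unfolding w_def v_def by (rule div_mult_mod_eq[symmetric])
  moreover have "0 \<le> v" "v < m1" "0 \<le> w"
    using m1_pos N0b by (auto simp: w_def v_def pos_imp_zdiv_nonneg_iff)
  ultimately have wv: "N0 = w * m1 + v" "0 \<le> v" "v < m1" "0 \<le> w" by blast+
  have unf: "Nhat m k l N x = (if \<exists>j\<in>{1..w}. x = l - (j - 1) * m0 then m1
      else if x = l - w * m0 then v else 0)"
    using small m1 unfolding Nhat_unfold Let_def N0[symmetric] w_def v_def by simp
  consider (full) j where "j \<in> {1..w}" "x = l - (j - 1) * m0"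
    | (partial) "\<not> (\<exists>j\<in>{1..w}. x = l - (j - 1) * m0)" "x = l - w * m0"
    | (none) "\<not> (\<exists>j\<in>{1..w}. x = l - (j - 1) * m0)" "x \<noteq> l - w * m0" by blast
  then show ?thesis
  proof cases
    case full
    have x_eq: "x = l + 0 * k - (j - 1) * m0" using full by simp
    have "j * m1 \<le> w * m1" using full m1_pos by (intro mult_right_mono) auto
    then have le: "(j - 1) * m1 + m1 \<le> N0" using wv by (unfold left_diff_distrib) linarith
    \<comment> \<open>A runner below \<open>m0\<close> has room for \<open>m1 + 1\<close> beads, but
      here \<open>j - 1 = q 0\<close> and the case bound stops the walk one bead earlier.\<close>
    have "N0 - (j - 1) * m1 \<le> m1" if "x < m0"
      using q_range(3)[OF x_eq x] that small by simp
    then show ?thesis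
      using card_J[OF x_eq x, of N0] le full N0b m1_pos unf by auto
  next
    case partial
    have x_eq: "x = l + 0 * k - w * m0" using partial by simp
    show ?thesis
      using card_J[OF x_eq x, of N0] wv partial N0b unf by auto
  next
    case none
    have "J N0 x = {}"
    proof (rule ccontr)
      assume "J N0 x \<noteq> {}"
      then obtain i where "i \<in> J N0 x" by blast
      from J_origin[OF this x(1)] obtain n t
        where nt: "0 \<le> n" "0 \<le> t" "x = l + t * k - n * m0" "n * m1 + t < N0" .
      have "t = 0"
      proof (rule ccontr)
        assume "t \<noteq> 0"
        then have "q 0 + 1 \<le> n" using q_range(2)[OF nt(3) x] q_mono[of 0 "t - 1"] nt(2) by simp
        then have "(q 0 + 1) * m1 \<le> n * m1" using m1_pos by (intro mult_right_mono) auto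
        then show False using nt small \<open>t \<noteq> 0\<close> by (unfold distrib_right) linarith
      qed
      then have "n * m1 < (w + 1) * m1" using nt(4) wv by (unfold distrib_right) linarith
      then have "n \<le> w" using m1_pos by simp
      then show False using none nt \<open>t = 0\<close> by (cases "n = w") (auto dest: bspec[of _ _ "n + 1"])
    qed
    then show ?thesis using none unf by simp
  qed
qed

text \<open>The first \<open>r\<close> runners below \<open>m0\<close> are full and account for
  \<open>r\<close> extra beads; the remaining \<open>N0 - r\<close> beads come in portions of
  \<open>m1\<close>, which explains the quotient \<open>w\<close> and the remainder
  \<open>v\<close>.\<close>

lemma Nhat_eq_card_J_case_II:
  assumes m1: "m1 \<noteq> 0" and x: "0 \<le> x" "x < k" and N0: "N0 = N mod mh"
    and large: "q 0 * m1 + m1 + 1 \<le> N0"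
  shows "Nhat m k l N x = int (card (J N0 x))"
proof -
  have m1_pos: "0 < m1" using m1 m1_nonneg by simp
  have N0b: "0 \<le> N0" "N0 < mh" using mh_pos by (auto simp: N0)
  define r where "r = proc_r m k l N"
  have r: "1 \<le> r" "q (r - 1) * m1 + m1 + r \<le> N0" "N0 < q r * m1 + m1 + r + 1"
    using proc_r_spec[OF N0 large] by (auto simp: r_def)
  define w v where "w = (N0 - r) div m1" and "v = (N0 - r) mod m1"
  have q0: "0 \<le> q (r - 1)" using r(1) by (intro q_nonneg) simp
  have "r \<le> N0" using r(2) q0 m1_pos mult_nonneg_nonneg[of "q (r - 1)" m1] by linarith
  then have "0 \<le> v" "v < m1" "0 \<le> w"
    using m1_pos by (auto simp: w_def v_def pos_imp_zdiv_nonneg_iff)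
  moreover have "N0 - r = w * m1 + v" unfolding w_def v_def by (rule div_mult_mod_eq[symmetric])
  ultimately have wv: "N0 - r = w * m1 + v" "0 \<le> v" "v < m1" "0 \<le> w" by blast+
  \<comment> \<open>The run on the runner below \<open>m0\<close> with index \<open>t\<close> ends
    no later than \<open>N0\<close>; so do all earlier runs, and every runner with
    \<open>t \<le> r - 1\<close> is full.\<close>
  have early: "q t * m1 + t + m1 + 1 \<le> N0" if "t \<le> r - 1" for t
    using mult_right_mono[OF q_mono[OF that] m1_nonneg] r(2) that by linarith
  define A where "A \<longleftrightarrow> (\<exists>j\<in>{1..r}. x = (l + (j - 1) * k) mod m0)"
  define B where "B \<longleftrightarrow> (\<exists>j\<in>{1..q 0}. x = l - (j - 1) * m0) \<or>
      (\<exists>t\<in>{1..r - 1}. \<exists>j\<in>{q (t - 1) + 1<..q t}. x = l + t * k - (j - 1) * m0) \<or>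
      (\<exists>j\<in>{q (r - 1) + 1<..w}. x = l + r * k - (j - 1) * m0)"
  have unf: "Nhat m k l N x =
      (if A then m1 + 1 else if B then m1 else if x = l + r * k - w * m0 then v else 0)"
    using large m1 unfolding Nhat_unfold Let_def N0[symmetric] r_def[symmetric] w_def v_def A_def B_def
    by simp
  have full: "int (card (J N0 x)) = m1"
    if "0 \<le> n" "0 \<le> t" "t \<le> r - 1" "n < q t" "x = l + t * k - n * m0" for n t
  proof -
    have "n * m1 \<le> q t * m1" using that m1_pos by (intro mult_right_mono) auto
    then have "n * m1 + t + m1 + 1 \<le> N0" using early[OF that(3)] by linarith
    moreover have "\<not> x < m0" using q_range(3)[OF that(5) x] that(4) by simp
    ultimately show ?thesis
      using card_J[OF that(5) x that(1,2), of N0] N0b m1_pos by auto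
  qed
  consider (A) "A" | (B) "B" "\<not> A" | (partial) "\<not> A" "\<not> B" "x = l + r * k - w * m0"
    | (none) "\<not> A" "\<not> B" "x \<noteq> l + r * k - w * m0" by blast
  then show ?thesis
  proof cases
    case A
    then obtain j where j: "j \<in> {1..r}" "x = (l + (j - 1) * k) mod m0" by (auto simp: A_def)
    define t where "t = j - 1"
    have t: "0 \<le> t" "t \<le> r - 1" using j by (auto simp: t_def)
    have x_eq: "x = l + t * k - q t * m0" using q_div(1)[of t] j(2) by (simp add: t_def)
    have "x < m0" using q_range(3)[OF x_eq x] by simp
    then show ?thesis
      using card_J[OF x_eq x q_nonneg[OF t(1)] t(1), of N0] early[OF t(2)] N0b m1_pos A unf by auto
  next
    case B
    then consider j where "j \<in> {1..q 0}" "x = l - (j - 1) * m0"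
      | t j where "t \<in> {1..r - 1}" "j \<in> {q (t - 1) + 1<..q t}" "x = l + t * k - (j - 1) * m0"
      | j where "j \<in> {q (r - 1) + 1<..w}" "x = l + r * k - (j - 1) * m0"
      unfolding B_def by blast
    then have "int (card (J N0 x)) = m1"
    proof cases
      case 1
      then show ?thesis using full[of "j - 1" 0] r(1) by simp
    next
      case 2
      then show ?thesis using full[of "j - 1" t] q_nonneg[of "t - 1"] by simp
    next
      case 3
      have "j * m1 \<le> w * m1" using 3 m1_pos by (intro mult_right_mono) auto
      then have le: "(j - 1) * m1 + r + m1 \<le> N0" using wv by (unfold left_diff_distrib) linarith
      have "N0 - ((j - 1) * m1 + r) \<le> m1" if "x < m0"
        using q_range(3)[OF 3(2) x] that r(3) by simp
      then show ?thesis
        using card_J[OF 3(2) x, of N0] le 3(1) q0 r(1) N0b m1_pos by auto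
    qed
    then show ?thesis using B unf by simp
  next
    case partial
    then show ?thesis using card_J[OF partial(3) x, of N0] wv r(1) N0b unf by auto
  next
    case none
    have "J N0 x = {}"
    proof (rule ccontr)
      assume "J N0 x \<noteq> {}"
      then obtain i where "i \<in> J N0 x" by blast
      from J_origin[OF this x(1)] obtain n t
        where nt: "0 \<le> n" "0 \<le> t" "x = l + t * k - n * m0" "n * m1 + t < N0" .
      note range = q_range[OF nt(3) x]
      \<comment> \<open>A visited runner with \<open>t \<le> r - 1\<close> is one of the full ones,
        with \<open>t = r\<close> it is number \<open>n \<le> w\<close> of the last stretch, and
        with \<open>t > r\<close> it would start only after time \<open>N0\<close>.\<close>
      consider "t \<le> r - 1" | "t = r" | "r + 1 \<le> t" by linarith
      then show False
      proof cases
        case 1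
        show False
        proof (cases "n = q t")
          case True
          then have "x = (l + t * k) mod m0" using nt(3) q_div(1)[of t] by simp
          then have A unfolding A_def using nt(2) 1 by (intro bexI[of _ "t + 1"]) auto
          then show False using none by simp
        next
          case False
          then have "n < q t" using range by simp
          have B
          proof (cases "t = 0")
            case True
            then show B unfolding B_def using nt \<open>n < q t\<close>
              by (intro disjI1 bexI[of _ "n + 1"]) auto
          next
            case False
            then show B unfolding B_def using nt \<open>n < q t\<close> 1 range
              by (intro disjI2 disjI1 bexI[of _ t] bexI[of _ "n + 1"]) auto
          qed
          then show False using none by simp
        qed
      next
        case 2
        have "n * m1 < (w + 1) * m1" using nt(4) wv 2 by (unfold distrib_right) linarith
        then have "n \<le> w" using m1_pos by simp
        moreover have "n \<noteq> w" using none nt 2 by auto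
        ultimately have B unfolding B_def using range nt 2
          by (intro disjI2 bexI[of _ "n + 1"]) auto
        then show False using none by simp
      next
        case 3
        then have "q r + 1 \<le> n" using range q_mono[of r "t - 1"] by simp
        then have "(q r + 1) * m1 \<le> n * m1" using m1_pos by (intro mult_right_mono) auto
        then show False using nt r(3) 3 by (unfold distrib_right) linarith
      qed
    qed
    then show ?thesis using none unf by simp
  qed
qed

lemma Nhat_eq_card_J:
  assumes "0 \<le> x" "x < k"
  shows "Nhat m k l N x = int (card (J (N mod mh) x))"
  using assms Nhat_eq_card_J_m1_zero[of x N] Nhat_eq_card_J_case_I[of x "N mod mh" N]
    Nhat_eq_card_J_case_II[of x "N mod mh" N]
  by linarith

end

subsection \<open>Counting beads from the first gap\<close>

text \<open>The \<open>c\<close> zero parts occupy exactly the positions below \<open>c\<close>,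
  while positive parts give beads above \<open>c\<close>. Passing to \<open>length lam\<close> beads
  drops the former and lowers the latter by \<open>c\<close>, the first gap.\<close>

lemma beads_eq_card_betas:
  assumes lam: "is_partition lam" and len: "length lam \<le> r"
  defines "c \<equiv> r - length lam"
  shows "beads k lam (length lam) i = card {x \<in> betas lam r. c \<le> x \<and> (x - c) mod k = i}"
    and "{..<c} \<subseteq> betas lam r" and "c \<notin> betas lam r"
proof -
  have beta_le: "c < beta lam r j \<and> beta lam (length lam) j = beta lam r j - c"
    if "1 \<le> j" "j \<le> length lam" for j
    using that part_pos_iff[OF lam, of j] len by (auto simp: beta_def c_def)
  have beta_gt: "beta lam r j = r - j \<and> r - j < c" if "length lam < j" "j \<le> r" for j
    using that by (auto simp: beta_def c_def part_def)
  have inj: "inj_on (beta lam r) {j \<in> {1..length lam}. beta lam (length lam) j mod k = i}"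
    by (rule inj_on_subset[OF inj_on_beta[OF lam, of r]]) (use len in auto)
  have "{x \<in> betas lam r. c \<le> x \<and> (x - c) mod k = i} =
      beta lam r ` {j \<in> {1..length lam}. beta lam (length lam) j mod k = i}"
  proof (intro equalityI subsetI)
    fix x assume "x \<in> {x \<in> betas lam r. c \<le> x \<and> (x - c) mod k = i}"
    then obtain j where j: "j \<in> {1..r}" "x = beta lam r j" "c \<le> x" "(x - c) mod k = i"
      unfolding betas_def by blast
    then have "j \<le> length lam" using beta_gt[of j] by force
    then show "x \<in> beta lam r ` {j \<in> {1..length lam}. beta lam (length lam) j mod k = i}"
      using j beta_le[of j] by (intro image_eqI[of _ _ j]) auto
  next
    fix x assume "x \<in> beta lam r ` {j \<in> {1..length lam}. beta lam (length lam) j mod k = i}"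
    then obtain j where j: "j \<in> {1..length lam}" "beta lam (length lam) j mod k = i" "x = beta lam r j"
      by blast
    then have "x \<in> betas lam r" using len by (auto simp: betas_def)
    then show "x \<in> {x \<in> betas lam r. c \<le> x \<and> (x - c) mod k = i}"
      using j beta_le[of j] by simp
  qed
  then show "beads k lam (length lam) i = card {x \<in> betas lam r. c \<le> x \<and> (x - c) mod k = i}"
    by (simp only: beads_def card_image[OF inj])
  show "{..<c} \<subseteq> betas lam r"
  proof
    fix x assume "x \<in> {..<c}"
    then have "x < c" by simp
    then have "beta lam r (r - x) = x" "r - x \<in> {1..r}"
      using beta_gt[of "r - x"] by (auto simp: c_def)
    then show "x \<in> betas lam r" unfolding betas_def by (metis imageI)
  qed
  show "c \<notin> betas lam r"
  proof
    assume "c \<in> betas lam r"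
    then obtain j where j: "j \<in> {1..r}" "c = beta lam r j" by (auto simp: betas_def)
    then show False using beta_le[of j] beta_gt[of j] by (cases "j \<le> length lam") auto
  qed
qed

text \<open>All positions below \<open>c\<close> are filled and \<open>c\<close> is empty, so
  \<open>c div k\<close> is the least runner count and \<open>c mod k\<close> the first runner
  attaining it. These are the minimum and the index that the procedure extracts from the
  counts.\<close>

lemma flush_gap:
  assumes P: "finite P" "flush k P" and gap: "{..<c} \<subseteq> P" "c \<notin> P" and x: "x < k"
  shows "c div k \<le> card (runner k P x)"
    and "x < c mod k \<Longrightarrow> c div k < card (runner k P x)"
    and "card (runner k P (c mod k)) = c div k"
proof -
  have c: "c = c mod k + k * (c div k)" and k: "0 < k" using x by auto
  have *: "c div k \<le> card (runner k P x)" if "x < k" for x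
  proof (cases "c div k = 0")
    case False
    then have "k * (c div k - 1) + k = k * (c div k)" by (cases "c div k") auto
    then have "x + k * (c div k - 1) < c" using that c by linarith
    then have "x + k * (c div k - 1) \<in> P" using gap by auto
    then show ?thesis using flush_mem_iff[OF P that] by fastforce
  qed simp
  show "c div k \<le> card (runner k P x)" using x by (rule *)
  show "x < c mod k \<Longrightarrow> c div k < card (runner k P x)"
  proof -
    assume "x < c mod k"
    then have "x + k * (c div k) < c" using c by linarith
    then have "x + k * (c div k) \<in> P" using gap by auto
    then show ?thesis using flush_mem_iff[OF P x] by blast
  qed
  have "\<not> c div k < card (runner k P (c mod k))"
    using flush_mem_iff[OF P, of "c mod k" "c div k"] gap(2) c k by simp
  then show "card (runner k P (c mod k)) = c div k" using *[of "c mod k"] k by simp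
qed

text \<open>Counting from \<open>c\<close>, runner \<open>i\<close> is the old runner
  \<open>i + c mod k\<close>, taken cyclically. It loses its beads below \<open>c\<close>, which
  number \<open>c div k\<close>, and one more if the index wraps around; \<open>e\<close> records
  this carry.\<close>

lemma card_runner_from_gap:
  assumes P: "finite P" "flush k P" and gap: "{..<c} \<subseteq> P" "c \<notin> P" and i: "i < k"
  defines "h \<equiv> \<lambda>x. int (card (runner k P x))"
  shows "int (card {x \<in> P. c \<le> x \<and> (x - c) mod k = i}) =
     (if i + c mod k < k then h (i + c mod k) - int (c div k)
      else h (i + c mod k - k) - int (c div k) - 1)"
proof -
  define e x0 where "e = (if i + c mod k < k then 0 else 1 :: nat)"
    and "x0 = (if i + c mod k < k then i + c mod k else i + c mod k - k)"
  have "c mod k < k" using i by simp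
  then have "i + c mod k - k < k" using i by linarith
  then have x0: "x0 < k" "i + c mod k = x0 + k * e" by (auto simp: x0_def e_def)
  have shift: "c + i + k * w = x0 + k * (c div k + w + e)" for w
  proof -
    have "c + i + k * w = (i + c mod k) + k * (c div k) + k * w" by simp
    then show ?thesis unfolding x0(2) by (simp only: distrib_left add_ac)
  qed
  define n where "n = card (runner k P x0) - (c div k + e)"
  have "{x \<in> P. c \<le> x \<and> (x - c) mod k = i} = (\<lambda>w. c + i + k * w) ` {..<n}"
  proof (intro equalityI subsetI)
    fix x assume x: "x \<in> {x \<in> P. c \<le> x \<and> (x - c) mod k = i}"
    define w where "w = (x - c) div k"
    have "x - c = i + k * w" using x mod_mult_div_eq[of "x - c" k] by (simp add: w_def)
    then have eq: "x = c + i + k * w" using x by auto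
    then have "x0 + k * (c div k + w + e) \<in> P" using x shift[of w] by simp
    then have "w < n" using flush_mem_iff[OF P x0(1)] by (simp add: n_def)
    then show "x \<in> (\<lambda>w. c + i + k * w) ` {..<n}" using eq by blast
  next
    fix x assume "x \<in> (\<lambda>w. c + i + k * w) ` {..<n}"
    then obtain w where w: "w < n" "x = c + i + k * w" by blast
    then have "c div k + w + e < card (runner k P x0)" by (simp add: n_def)
    then have "x \<in> P" using flush_mem_iff[OF P x0(1)] w(2) shift[of w] by simp
    then show "x \<in> {x \<in> P. c \<le> x \<and> (x - c) mod k = i}" using w i by simp
  qed
  moreover have "inj (\<lambda>w. c + i + k * w)" using i by (intro injI) auto
  ultimately have "card {x \<in> P. c \<le> x \<and> (x - c) mod k = i} = n"
    by (simp add: card_image inj_on_subset)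
  moreover have "c div k + e \<le> card (runner k P x0)"
  proof (cases "i + c mod k < k")
    case False
    then have "x0 < c mod k" "e = 1" using i by (simp_all add: x0_def e_def)
    then show ?thesis using flush_gap(2)[OF P gap x0(1)] by simp
  qed (use flush_gap(1)[OF P gap x0(1)] in \<open>simp add: e_def\<close>)
  ultimately show ?thesis
    by (auto simp: n_def h_def e_def x0_def)
qed

lemma card_residue_class:
  fixes n k x :: nat
  assumes "x < k"
  shows "card {y \<in> {..<n}. y mod k = x} = n div k + (if x < n mod k then 1 else 0)"
proof -
  have fl: "flush k {..<n}" by (auto simp: flush_def)
  have n: "n = n mod k + k * (n div k)" by simp
  have "n mod k < k" using assms by simp
  have "s < card (runner k {..<n} x) \<longleftrightarrow> s < n div k + (if x < n mod k then 1 else 0)" for s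
  proof -
    have "s < card (runner k {..<n} x) \<longleftrightarrow> x + k * s < n"
      using flush_mem_iff[OF _ fl assms, of s] by simp
    also have "\<dots> \<longleftrightarrow> s < n div k + (if x < n mod k then 1 else 0)"
    proof (cases s "n div k" rule: linorder_cases)
      case less
      then have "k * (s + 1) \<le> k * (n div k)" by (intro mult_le_mono2) simp
      then have "k * s + k \<le> k * (n div k)" by simp
      then have "x + k * s < n" using n assms by linarith
      then show ?thesis using less by simp
    next
      case equal
      have "x + k * (n div k) < n \<longleftrightarrow> x < n mod k" using n by linarith
      then show ?thesis using equal by simp
    next
      case greater
      then have "k * (n div k + 1) \<le> k * s" by (intro mult_le_mono2) simp
      then have "k * (n div k) + k \<le> k * s" by simp
      then have "\<not> x + k * s < n" using n \<open>n mod k < k\<close> by linarith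
      then show ?thesis using greater by simp
    qed
    finally show ?thesis .
  qed
  then show ?thesis by (metis less_irrefl linorder_neqE_nat)
qed

subsection \<open>The bead configuration of the core\<close>

lemma WH_partition_properties:
  assumes "1 \<le> l" "2 \<le> k"
  shows "is_partition (WH_partition N k l)" "length (WH_partition N k l) = N"
    "betas (WH_partition N k l) N = (\<lambda>j. l + j * k) ` {..<N}"
proof -
  have "0 \<notin> set (WH_partition N k l)" using assms by (auto simp: WH_partition_def)
  moreover have "sorted_wrt (\<ge>) (WH_partition N k l)"
    by (auto simp: WH_partition_def sorted_wrt_iff_nth_less simp del: upt_Suc intro: mult_right_mono)
  ultimately show "is_partition (WH_partition N k l)" by (simp add: is_partition_def)
  show len: "length (WH_partition N k l) = N" by (simp add: WH_partition_def)
  have beta: "beta (WH_partition N k l) N i = l + (N - i) * k" if "i \<in> {1..N}" for i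
  proof -
    have "part (WH_partition N k l) i = (N - i) * (k - 1) + l"
      using that by (cases i) (auto simp: part_def WH_partition_def simp del: upt_Suc)
    moreover have "(N - i) * k = (N - i) * (k - 1) + (N - i)"
      using assms(2) by (cases k) auto
    ultimately show ?thesis using that unfolding beta_def atLeastAtMost_iff by linarith
  qed
  have "betas (WH_partition N k l) N = (\<lambda>i. l + (N - i) * k) ` {1..N}"
    unfolding betas_def using beta by (intro image_cong) auto
  also have "\<dots> = (\<lambda>j. l + j * k) ` ((\<lambda>i. N - i) ` {1..N})" by (simp add: image_image)
  also have "(\<lambda>i. N - i) ` {1..N} = {..<N}"
  proof (intro equalityI subsetI)
    fix j assume "j \<in> {..<N}"
    then show "j \<in> (\<lambda>i. N - i) ` {1..N}" by (intro image_eqI[of _ _ "N - j"]) auto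
  qed auto
  finally show "betas (WH_partition N k l) N = (\<lambda>j. l + j * k) ` {..<N}" .
qed

lemma add_dvd_mod_eq:
  fixes a b g :: nat
  shows "g dvd b \<Longrightarrow> (a + b) mod g = a mod g"
  by (auto elim!: dvdE)

locale wh_nat =
  fixes m k l N :: nat
  assumes m_pos: "0 < m" and l_less: "l < k" and k_ndvd: "\<not> k dvd m"
begin

sublocale Z: wh_params "int m" "int k" "int l"
  by unfold_locales (use m_pos l_less k_ndvd in auto)

definition "g = gcd m k"
definition "mn = m div g"
definition "kn = k div g"
definition "kN = N div mn"
definition "N0 = N mod mn"
definition "res i = (l + i * k) mod m"
text \<open>Flushing the initial beads on the \<open>m\<close>-abacus: beads
  \<open>l + i * k\<close> on one runner have indices congruent modulo \<open>mn\<close>, and the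
  one with index \<open>i\<close> is put at height \<open>i div mn\<close>.\<close>

definition "phi i = res i + m * (i div mn)"
definition "P = phi ` {..<N}"
definition "A = res ` {..<N0}"

lemma int_g: "int g = Z.d" by (simp add: g_def Z.d_def)

lemma int_mn: "int mn = Z.mh" by (simp add: mn_def Z.mh_def int_g[symmetric] zdiv_int)

lemma int_kn: "int kn = Z.kh" by (simp add: kn_def Z.kh_def int_g[symmetric] zdiv_int)

lemma k_pos: "0 < k" using l_less by simp

lemma g_pos: "0 < g" using m_pos by (simp add: g_def)

lemma g_dvd: "g dvd m" "g dvd k" by (simp_all add: g_def)

lemma m_eq: "m = g * mn" by (simp add: mn_def g_def)

lemma k_eq: "k = g * kn" by (simp add: kn_def g_def)

lemma mn_pos: "0 < mn" using m_eq m_pos by (cases mn) auto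

lemma kn_pos: "0 < kn" using k_eq k_pos by (cases kn) auto

lemma N_eq: "N = kN * mn + N0" unfolding kN_def N0_def by (rule div_mult_mod_eq[symmetric])

lemma N0_less: "N0 < mn" using mn_pos by (simp add: N0_def)

lemma int_res: "int (res i) = (int l + int i * int k) mod int m"
  by (simp add: res_def zmod_int)

lemma res_less: "res i < m" using m_pos by (simp add: res_def)

lemma res_mod_g: "res i mod g = l mod g"
proof -
  have "res i mod g = (l + i * k) mod g"
    unfolding res_def by (rule mod_mod_cancel) (simp add: g_def)
  also have "\<dots> = l mod g" using g_dvd by (simp add: add_dvd_mod_eq)
  finally show ?thesis .
qed

lemma res_eq_iff: "res i = res j \<longleftrightarrow> i mod mn = j mod mn"
proof -
  have "res i = res j \<longleftrightarrow> int (res i) = int (res j)" by simp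
  also have "\<dots> \<longleftrightarrow> int mn dvd int i - int j"
    unfolding int_res Z.mod_m_eq_iff int_mn ..
  also have "\<dots> \<longleftrightarrow> i mod mn = j mod mn"
    by (simp add: mod_eq_dvd_iff[symmetric] zmod_int[symmetric])
  finally show ?thesis .
qed

lemma inj_phi: "inj phi"
proof (rule injI)
  fix i j assume eq: "phi i = phi j"
  have "phi i div m = i div mn" "phi i mod m = res i" for i
    using res_less[of i] m_pos by (auto simp: phi_def)
  with eq have "i div mn = j div mn" "res i = res j" by metis+
  then show "i = j" using res_eq_iff[of i j] by (metis div_mult_mod_eq)
qed

lemma inj_on_res: "inj_on res {..<N0}"
  using N0_less by (auto intro!: inj_onI simp: res_eq_iff)

lemma finite_P: "finite P" by (simp add: P_def)

lemma finite_A: "finite A" by (simp add: A_def)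

text \<open>Moving down by \<open>m\<close> amounts to replacing the index \<open>i\<close> by
  \<open>i - mn\<close>.\<close>

lemma flush_m_P: "flush m P"
  unfolding flush_def
proof (intro ballI impI)
  fix x assume "x \<in> P" "m \<le> x"
  then obtain i where i: "i < N" "x = phi i" by (auto simp: P_def)
  have "i div mn \<noteq> 0"
  proof
    assume "i div mn = 0"
    then have "phi i = res i" unfolding phi_def by simp
    then show False using \<open>m \<le> x\<close> i(2) res_less[of i] by simp
  qed
  then have "mn \<le> i" by (metis div_less not_less)
  then have "(i - mn) div mn = i div mn - 1" "res (i - mn) = res i"
    using mn_pos by (auto simp: le_div_geq res_eq_iff le_mod_geq)
  then have "phi (i - mn) = x - m"
    using \<open>i div mn \<noteq> 0\<close> i(2) by (cases "i div mn") (auto simp: phi_def)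
  then show "x - m \<in> P" using i(1) unfolding P_def by (metis imageI lessThan_iff less_imp_diff_less)
qed

lemma card_runner_P:
  "card (runner m P c) = card (runner m ((\<lambda>j. l + j * k) ` {..<N}) c)"
proof -
  define I where "I = {i \<in> {..<N}. res i = c}"
  have "phi i mod m = res i" for i using res_less[of i] by (simp add: phi_def)
  then have "runner m P c = phi ` I" by (auto simp: P_def I_def)
  then have "card (runner m P c) = card I"
    by (simp add: card_image inj_on_subset[OF inj_phi])
  moreover have "runner m ((\<lambda>j. l + j * k) ` {..<N}) c = (\<lambda>j. l + j * k) ` I"
    by (auto simp: I_def res_def)
  moreover have "inj (\<lambda>j. l + j * k)" using k_pos by (auto intro: injI)
  ultimately show ?thesis by (simp add: card_image inj_on_subset)
qed

text \<open>The \<open>kN\<close> complete periods land below \<open>kN * m\<close> in the class of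
  \<open>l\<close> modulo \<open>g\<close>, and they fill it because both sets have
  \<open>kN * mn\<close> elements. The \<open>N0\<close> remaining indices give the translate of
  \<open>A\<close>.\<close>

lemma P_eq: "P = {y \<in> {..<kN * m}. y mod g = l mod g} \<union> (\<lambda>a. kN * m + a) ` A"
proof -
  define L where "L = {y \<in> {..<kN * m}. y mod g = l mod g}"
  have "{..<N} = {..<kN * mn} \<union> (\<lambda>i. kN * mn + i) ` {..<N0}"
  proof (intro equalityI subsetI)
    fix i assume "i \<in> {..<N}"
    then show "i \<in> {..<kN * mn} \<union> (\<lambda>i. kN * mn + i) ` {..<N0}"
      using N_eq by (cases "i < kN * mn") (auto intro!: image_eqI[of _ _ "i - kN * mn"])
  qed (use N_eq in auto)
  moreover have "phi ` (\<lambda>i. kN * mn + i) ` {..<N0} = (\<lambda>a. kN * m + a) ` A"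
  proof -
    have "phi (kN * mn + i) = kN * m + res i" if "i < N0" for i
    proof -
      have "res (kN * mn + i) = res i" by (simp add: res_eq_iff)
      moreover have "(kN * mn + i) div mn = kN" using that N0_less by simp
      ultimately show ?thesis by (simp add: phi_def)
    qed
    then show ?thesis unfolding A_def image_image by (intro image_cong) auto
  qed
  moreover have "phi ` {..<kN * mn} = L"
  proof (rule card_subset_eq)
    show "finite L" by (simp add: L_def)
    show "phi ` {..<kN * mn} \<subseteq> L"
    proof
      fix y assume "y \<in> phi ` {..<kN * mn}"
      then obtain i where i: "i < kN * mn" "y = phi i" by auto
      then have "i div mn + 1 \<le> kN" using mn_pos by (simp add: div_less_iff_less_mult Suc_le_eq)
      then have "m * (i div mn + 1) \<le> m * kN" by (rule mult_le_mono2)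
      then have "y < kN * m" using i(2) res_less[of i] by (simp add: phi_def mult.commute)
      moreover have "y mod g = l mod g"
        using res_mod_g[of i] g_dvd i(2) by (simp add: phi_def add_dvd_mod_eq)
      ultimately show "y \<in> L" by (simp add: L_def)
    qed
    have "kN * m mod g = 0" using g_dvd by simp
    then have "card L = kN * m div g"
      unfolding L_def using card_residue_class[of "l mod g" g "kN * m"] g_pos by simp
    also have "\<dots> = kN * mn" using g_dvd by (simp add: mn_def div_mult_swap)
    finally show "card (phi ` {..<kN * mn}) = card L"
      by (simp add: card_image inj_on_subset[OF inj_phi])
  qed
  ultimately have "P = L \<union> (\<lambda>a. kN * m + a) ` A" by (simp only: P_def image_Un)
  then show ?thesis by (simp only: L_def)
qed

text \<open>A position \<open>a \<ge> k\<close> of the walk was reached without a wrap, so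
  \<open>a - k\<close> is the position one time step before; there is such a step because
  \<open>res 0 \<le> l < k\<close>.\<close>

lemma flush_k_A: "flush k A"
  unfolding flush_def
proof (intro ballI impI)
  fix a assume "a \<in> A" "k \<le> a"
  then obtain i where i: "i < N0" "a = res i" by (auto simp: A_def)
  have "res 0 \<le> l" by (simp add: res_def)
  then have "i \<noteq> 0" using \<open>k \<le> a\<close> i(2) l_less by (cases i) auto
  then obtain j where j: "i = Suc j" by (cases i) auto
  have "l + i * k = m * ((l + i * k) div m) + a" by (simp add: i(2) res_def)
  then have "l + j * k = m * ((l + i * k) div m) + (a - k)" using j \<open>k \<le> a\<close> by simp
  then have "res j = (a - k) mod m" unfolding res_def by (metis mod_mult_self4 add.commute)
  also have "\<dots> = a - k" using res_less[of i] i(2) by simp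
  finally show "a - k \<in> A" unfolding A_def using i(1) j by (metis Suc_lessD imageI lessThan_iff)
qed

lemma P_mod_g: "y \<in> P \<Longrightarrow> y mod g = l mod g"
  using g_dvd by (auto simp: P_def phi_def add_dvd_mod_eq res_mod_g)

text \<open>Subtracting \<open>k\<close> keeps the class modulo \<open>g\<close>, so the periodic
  part is no obstacle; above \<open>kN * m\<close> the claim is that for \<open>A\<close>.\<close>

lemma flush_k_P: "flush k P"
  unfolding flush_def
proof (intro ballI impI)
  fix y assume y: "y \<in> P" "k \<le> y"
  have "(y - k) mod g = y mod g"
    using add_dvd_mod_eq[OF g_dvd(2), of "y - k"] y(2) by simp
  moreover have "y mod g = l mod g" using y(1) by (rule P_mod_g)
  ultimately have low: "y - k \<in> P" if "y - k < kN * m" using that unfolding P_eq by simp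
  show "y - k \<in> P"
  proof (cases "y - k < kN * m")
    case False
    then obtain a where a: "a \<in> A" "y = kN * m + a" using y k_pos unfolding P_eq by auto
    then have "k \<le> a" using False y(2) by linarith
    then have "a - k \<in> A" using a(1) flush_k_A by (auto simp: flush_def)
    moreover have "y - k = kN * m + (a - k)" using a(2) \<open>k \<le> a\<close> by simp
    ultimately show ?thesis unfolding P_eq by blast
  qed (rule low)
qed

lemma Nhat_eq_card_runner_A:
  assumes "x < k"
  shows "Nhat (int m) (int k) (int l) (int N) (int x) = int (card (runner k A x))"
proof -
  define I where "I = {i \<in> {..<N0}. res i mod k = x}"
  have N0: "int N mod Z.mh = int N0" by (simp add: N0_def int_mn[symmetric] zmod_int)
  have "Z.J (int N0) (int x) = int ` I"
  proof (intro equalityI subsetI)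
    fix j assume "j \<in> Z.J (int N0) (int x)"
    then have j: "0 \<le> j" "j < int N0" "(int l + j * int k) mod int m mod int k = int x"
      by (auto simp: Z.J_def)
    then obtain i where i: "j = int i" by (metis nonneg_int_cases)
    then have "int (res i mod k) = int x" using j(3) by (simp add: int_res zmod_int)
    then have "res i mod k = x" by (simp only: of_nat_eq_iff)
    then show "j \<in> int ` I" using i j(2) by (auto simp: I_def)
  next
    fix j assume "j \<in> int ` I"
    then show "j \<in> Z.J (int N0) (int x)"
      by (auto simp: I_def Z.J_def int_res[symmetric] zmod_int[symmetric])
  qed
  moreover have "runner k A x = res ` I" by (auto simp: A_def I_def)
  moreover have "inj_on res I" by (rule inj_on_subset[OF inj_on_res]) (auto simp: I_def)
  ultimately show ?thesis
    using Z.Nhat_eq_card_J[of "int x" "int N"] assms N0 by (simp add: card_image)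
qed

end

subsection \<open>Matching the arithmetic procedure\<close>

text \<open>Taking \<open>j = 0\<close> as the first empty runner covers the branch without a shift,
  so one formula serves both branches.\<close>

lemma shift_runners_eq:
  assumes "0 \<le> j" "j < k" "\<And>x. 0 \<le> x \<Longrightarrow> x < j \<Longrightarrow> h x \<noteq> 0" "h j = 0" "i < k"
  shows "shift_runners k h i = (if i + j < k then h (i + j) else h (i + j - k) - 1)"
proof (cases "j = 0")
  case True
  then show ?thesis using assms(4,5) by (simp add: shift_runners_def)
next
  case False
  have "(THE j. 1 \<le> j \<and> j < k \<and> (\<forall>i\<in>{0..j - 1}. h i \<noteq> 0) \<and> h j = 0) = j"
  proof (rule the_equality)
    show "1 \<le> j \<and> j < k \<and> (\<forall>i\<in>{0..j - 1}. h i \<noteq> 0) \<and> h j = 0"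
      using assms False by auto
  next
    fix j' assume j': "1 \<le> j' \<and> j' < k \<and> (\<forall>i\<in>{0..j' - 1}. h i \<noteq> 0) \<and> h j' = 0"
    then have "\<not> j < j'" using assms(1,4) by force
    moreover have "\<not> j' < j" using j' assms(3)[of j'] by force
    ultimately show "j' = j" by simp
  qed
  moreover have "h 0 \<noteq> 0" using assms(1,3) False by simp
  ultimately show ?thesis by (auto simp: shift_runners_def Let_def)
qed

text \<open>If some runner is empty, \<open>b = 0\<close> and nothing is subtracted; otherwise
  \<open>b\<close> is \<open>rbar\<close>. In both situations \<open>j\<close> is the first empty
  runner after the subtraction.\<close>

lemma N_case1_eq:
  fixes m k l N :: int
  defines "h \<equiv> Nhat m k l N"
  assumes j: "0 \<le> j" "j < k" "h j = b" and b: "0 \<le> b"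
    and min: "\<And>x. 0 \<le> x \<Longrightarrow> x < k \<Longrightarrow> b \<le> h x" and less: "\<And>x. 0 \<le> x \<Longrightarrow> x < j \<Longrightarrow> b < h x"
    and i: "i < k"
  shows "N_case1 m k l N i = (if i + j < k then h (i + j) - b else h (i + j - k) - b - 1)"
proof (cases "\<forall>x\<in>{0..k - 1}. h x \<noteq> 0")
  case True
  have "Min (h ` {0..k - 1}) = b"
    using j min by (intro Min_eqI) auto
  moreover have "h x - b \<noteq> 0" if "0 \<le> x" "x < j" for x using less[OF that] by simp
  ultimately show ?thesis
    using True shift_runners_eq[OF j(1,2), of "\<lambda>x. h x - b" i] j(3) i
    by (simp add: N_case1_def h_def[symmetric] Let_def)
next
  case False
  then have "b = 0" using min b by fastforce
  moreover have "h x \<noteq> 0" if "0 \<le> x" "x < j" for x using less[OF that] b by simp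
  ultimately show ?thesis
    using shift_runners_eq[OF j(1,2), of h i] j(3) i
    unfolding N_case1_def h_def[symmetric] Let_def if_not_P[OF False] by simp
qed

context wh_nat
begin

text \<open>For \<open>g = 1\<close> the periodic part fills everything below \<open>kN * m\<close>,
  so the first gap lies beyond it; translating back leaves the first gap \<open>c'\<close> of
  \<open>A\<close>, whose runner counts are \<open>Nhat\<close>.\<close>

lemma N_case1_eq_card:
  assumes g1: "g = 1" and gap: "{..<c} \<subseteq> P" "c \<notin> P" and i: "i < k"
  shows "int (card {x \<in> P. c \<le> x \<and> (x - c) mod k = i}) =
    N_case1 (int m) (int k) (int l) (int N) (int i)"
proof -
  have P: "P = {..<kN * m} \<union> (\<lambda>a. kN * m + a) ` A" by (subst P_eq) (simp add: g1 lessThan_def)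
  have "kN * m \<le> c" using gap(2) P by (auto simp: not_less[symmetric])
  then obtain c' where c: "c = kN * m + c'" using le_Suc_ex by blast
  have gap': "{..<c'} \<subseteq> A" "c' \<notin> A"
  proof -
    show "{..<c'} \<subseteq> A"
    proof
      fix x assume "x \<in> {..<c'}"
      then have "kN * m + x \<in> P" using gap(1) c by auto
      then show "x \<in> A" unfolding P by auto
    qed
    show "c' \<notin> A" using gap(2) unfolding P c by blast
  qed
  have "{x \<in> P. c \<le> x \<and> (x - c) mod k = i} =
      (\<lambda>a. kN * m + a) ` {a \<in> A. c' \<le> a \<and> (a - c') mod k = i}"
    unfolding P c by auto
  then have "card {x \<in> P. c \<le> x \<and> (x - c) mod k = i} = card {a \<in> A. c' \<le> a \<and> (a - c') mod k = i}"
    by (simp add: card_image)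
  moreover have "int (card {a \<in> A. c' \<le> a \<and> (a - c') mod k = i}) =
      N_case1 (int m) (int k) (int l) (int N) (int i)"
  proof -
    define h where "h = Nhat (int m) (int k) (int l) (int N)"
    define j where "j = c' mod k"
    have j: "j < k" using k_pos by (simp add: j_def)
    have h: "h (int x) = int (card (runner k A x))" if "x < k" for x
      using Nhat_eq_card_runner_A[OF that] by (simp add: h_def)
    note gapA = flush_gap[OF finite_A flush_k_A gap']
    have hj: "h (int j) = int (c' div k)" using gapA(3)[of j] h[OF j] j by (simp add: j_def)
    have le: "int (c' div k) \<le> h x" if "0 \<le> x" "x < int k" for x
      using gapA(1)[of "nat x"] h[of "nat x"] that by (simp add: nat_less_iff)
    have less: "int (c' div k) < h x" if "0 \<le> x" "x < int j" for x
      using gapA(2)[of "nat x"] h[of "nat x"] that j by (simp add: nat_less_iff j_def)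
    have "N_case1 (int m) (int k) (int l) (int N) (int i) =
        (if int i + int j < int k then h (int i + int j) - int (c' div k)
         else h (int i + int j - int k) - int (c' div k) - 1)"
      unfolding h_def
      by (rule N_case1_eq) (use hj le less j i in \<open>auto simp: h_def[symmetric]\<close>)
    also have "\<dots> = (if i + j < k then int (card (runner k A (i + j))) - int (c' div k)
        else int (card (runner k A (i + j - k))) - int (c' div k) - 1)"
      using h[of "i + j"] h[of "i + j - k"] i j by (auto simp: of_nat_diff)
    finally show ?thesis
      using card_runner_from_gap[OF finite_A flush_k_A gap' i] by (simp add: j_def)
  qed
  ultimately show ?thesis by simp
qed

section \<open>Runner counts when the gcd is not 1\<close>

lemma lpos_eq: "lpos (int m) (int k) (int l) j = int (l mod g) + (j - 1) * int g"
  unfolding lpos_def Let_def Z.d_def[symmetric] int_g[symmetric] zmod_int ..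

text \<open>In the class of \<open>l\<close> modulo \<open>g\<close>, the runner \<open>x\<close> is
  the position with index \<open>x div g + 1\<close>.\<close>

lemma ex_lpos_iff:
  assumes x: "x < k" and l: "x mod g = l mod g" and w: "w \<le> kn"
  shows "(\<exists>j\<in>{1..int w}. int x = lpos (int m) (int k) (int l) j) \<longleftrightarrow> x < g * w"
    and "(\<exists>j\<in>{int w<..int kn}. int x = lpos (int m) (int k) (int l) j) \<longleftrightarrow> g * w \<le> x"
proof -
  define s where "s = x div g"
  have x_eq: "x = l mod g + s * g" using l div_mult_mod_eq[of x g] by (simp add: s_def)
  have eq: "int x = lpos (int m) (int k) (int l) j \<longleftrightarrow> j = int s + 1" for j
  proof -
    have "int x = int (l mod g) + int s * int g" using x_eq by (metis of_nat_add of_nat_mult)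
    then have "int x = lpos (int m) (int k) (int l) j \<longleftrightarrow> int s * int g = (j - 1) * int g"
      unfolding lpos_eq by linarith
    then show ?thesis using g_pos by auto
  qed
  have lt: "s < v \<longleftrightarrow> x < g * v" for v
    using g_pos by (simp add: s_def div_less_iff_less_mult mult.commute)
  have "s < kn" using lt[of kn] x k_eq by simp
  then show "(\<exists>j\<in>{1..int w}. int x = lpos (int m) (int k) (int l) j) \<longleftrightarrow> x < g * w"
    and "(\<exists>j\<in>{int w<..int kn}. int x = lpos (int m) (int k) (int l) j) \<longleftrightarrow> g * w \<le> x"
    unfolding eq not_less[symmetric] lt[symmetric] by auto
qed

lemma ex_lposD:
  assumes "int x = lpos (int m) (int k) (int l) j" "1 \<le> j"
  shows "x mod g = l mod g"
proof -
  have "lpos (int m) (int k) (int l) j = int (l mod g + nat (j - 1) * g)"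
    unfolding lpos_eq using assms(2) by simp
  then have "x = l mod g + nat (j - 1) * g" using assms(1) by linarith
  then show ?thesis by simp
qed

text \<open>Both \<open>kN * m\<close> and \<open>k\<close> are multiples of \<open>g\<close>, so
  division with remainder of \<open>kN * mn\<close> by \<open>kn\<close> is that of
  \<open>kN * m\<close> by \<open>k\<close>, with the remainder scaled by \<open>g\<close>.\<close>

lemma Ntilde1_eq:
  assumes x: "x < k" and l: "x mod g = l mod g"
  shows "Ntilde1 (int m) (int k) (int l) (int N) (int x) =
    int (card {y \<in> {..<kN * m}. y mod k = x})"
proof -
  define w where "w = kN * mn mod kn"
  have w: "w < kn" using kn_pos by (simp add: w_def)
  have km: "kN * m = g * (kN * mn)" "k = g * kn" using m_eq k_eq by auto
  have dv: "kN * m div k = kN * mn div kn" using km g_pos by (metis div_mult_mult1 less_not_refl)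
  have md: "kN * m mod k = g * w" unfolding w_def using km by (metis mult_mod_right)
  have kN: "int N div int mn = int kN" by (simp add: kN_def zdiv_int)
  have "Ntilde1 (int m) (int k) (int l) (int N) (int x) =
     (if \<exists>j\<in>{1..int w}. int x = lpos (int m) (int k) (int l) j then int (kN * mn div kn) + 1
      else if \<exists>j\<in>{int w<..int kn}. int x = lpos (int m) (int k) (int l) j then int (kN * mn div kn)
      else 0)"
    unfolding Ntilde1_def Let_def Z.d_def[symmetric] Z.mh_def[symmetric] Z.kh_def[symmetric] kN
      int_mn[symmetric] int_kn[symmetric] w_def
    by (simp only: zmod_int zdiv_int of_nat_mult)
  also have "\<dots> = int (kN * m div k + (if x < kN * m mod k then 1 else 0))"
    using ex_lpos_iff[OF x l less_imp_le[OF w]] by (simp add: dv md)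
  finally show ?thesis using card_residue_class[OF x, of "kN * m"] by simp
qed

text \<open>Runner \<open>x\<close> holds the periodic part, counted by \<open>Ntilde1\<close>, and
  beads of the translated \<open>A\<close>. Translation by \<open>kN * m\<close> rotates the runners
  by \<open>e\<close>, so the latter come from runner \<open>x'\<close> of \<open>A\<close>.\<close>

lemma Ntilde2_eq:
  assumes x: "x < k" and l: "x mod g = l mod g"
  shows "Ntilde2 (int m) (int k) (int l) (int N) (int x) = int (card (runner k P x))"
proof -
  define e where "e = kN * m mod k"
  have e: "e < k" using k_pos by (simp add: e_def)
  define x' where "x' = (if x < e then x + k - e else x - e)"
  have x': "x' < k" using x e by (auto simp: x'_def)
  have mod_eq: "(kN * m + a) mod k = x \<longleftrightarrow> a mod k = x'" for a
  proof -
    define u where "u = a mod k"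
    have u: "u < k" using k_pos by (simp add: u_def)
    have "(kN * m + a) mod k = (e + u) mod k" by (simp add: e_def u_def mod_add_eq)
    also have "\<dots> = (if e + u < k then e + u else e + u - k)"
      using e u by (auto simp: le_mod_geq)
    finally show ?thesis using e x u unfolding x'_def u_def[symmetric] by (auto split: if_splits)
  qed
  have g_mod: "y mod g = l mod g" if "y mod k = x" for y
    using mod_mod_cancel[OF g_dvd(2), of y] that l by simp
  have "runner k P x = {y \<in> {..<kN * m}. y mod k = x} \<union>
      (\<lambda>a. kN * m + a) ` {a \<in> A. (kN * m + a) mod k = x}"
    using g_mod unfolding P_eq by blast
  then have "runner k P x = {y \<in> {..<kN * m}. y mod k = x} \<union> (\<lambda>a. kN * m + a) ` runner k A x'"
    unfolding mod_eq .
  moreover have "{y \<in> {..<kN * m}. y mod k = x} \<inter> (\<lambda>a. kN * m + a) ` runner k A x' = {}" by auto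
  ultimately have "card (runner k P x) =
      card {y \<in> {..<kN * m}. y mod k = x} + card (runner k A x')"
    using finite_A by (simp add: card_Un_disjoint card_image)
  moreover have "Ntilde2 (int m) (int k) (int l) (int N) (int x) =
      Ntilde1 (int m) (int k) (int l) (int N) (int x) + Nhat (int m) (int k) (int l) (int N) (int x')"
  proof -
    have kN: "int N div Z.mh = int kN" by (simp add: kN_def int_mn[symmetric] zdiv_int)
    have "int kN * int m mod int k = int e" by (simp add: e_def zmod_int)
    then show ?thesis
      using e unfolding Ntilde2_def Let_def Z.d_def[symmetric] Z.mh_def[symmetric] kN
      by (auto simp: x'_def of_nat_diff)
  qed
  ultimately show ?thesis using Ntilde1_eq[OF x l] Nhat_eq_card_runner_A[OF x'] by simp
qed

lemma card_runner_P_zero: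
  assumes "x mod g \<noteq> l mod g"
  shows "card (runner k P x) = 0"
proof -
  have "runner k P x = {}" using P_mod_g mod_mod_cancel[OF g_dvd(2)] assms by force
  then show ?thesis by (simp only: card.empty)
qed

text \<open>As \<open>g \<ge> 2\<close> and \<open>P\<close> lies in one class modulo
  \<open>g\<close>, positions 0 and 1 are not both occupied. The first gap is therefore 1 if 0 is
  occupied, and 0 otherwise.\<close>

lemma N_case2_eq_card:
  assumes g1: "g \<noteq> 1" and gap: "{..<c} \<subseteq> P" "c \<notin> P" and i: "1 \<le> i" "i < k"
  shows "int (card {x \<in> P. c \<le> x \<and> (x - c) mod k = i}) =
    N_case2 (int m) (int k) (int l) (int N) (int i)"
proof -
  define T where "T x = card (runner k P x)" for x
  have g2: "2 \<le> g" using g1 g_pos by simp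
  have zero_in: "0 \<in> P \<longleftrightarrow> T 0 \<noteq> 0"
    using flush_mem_iff[OF finite_P flush_k_P k_pos, of 0] by (simp add: T_def)
  have c0: "c = 0" if "0 \<notin> P" using gap(1) that by (cases c) auto
  have at0: "int (card {x \<in> P. c \<le> x \<and> (x - c) mod k = i}) = int (T i)" if "c = 0"
    by (simp add: T_def that)
  have N2: "N_case2 (int m) (int k) (int l) (int N) (int i) =
     (let T = Ntilde2 (int m) (int k) (int l) (int N) in
      if \<not> g dvd l then
        (if \<exists>j\<in>{1..int kn}. int i = lpos (int m) (int k) (int l) j then T (int i) else 0)
      else if T 0 = 0 then
        (if \<exists>j\<in>{2..int kn}. int i = lpos (int m) (int k) (int l) j then T (int i) else 0)
      else
        (if int i = int k - 1 then T 0 - 1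
         else if \<exists>j\<in>{2..int kn}. int i = lpos (int m) (int k) (int l) j - 1 then T (int i + 1)
         else 0))"
    unfolding N_case2_def Let_def Z.d_def[symmetric] int_g[symmetric] kn_def zdiv_int
      of_nat_dvd_iff ..
  have ex1: "(\<exists>j\<in>{1..int kn}. int x = lpos (int m) (int k) (int l) j) \<longleftrightarrow> x mod g = l mod g"
    if "x < k" for x
    using ex_lpos_iff(1)[OF that _ order_refl] ex_lposD[of x] that k_eq by auto
  \<comment> \<open>For \<open>g dvd l\<close> the index 1 is the position 0, so for
    \<open>x \<ge> 1\<close> the search may start at 2.\<close>
  have ex2: "(\<exists>j\<in>{2..int kn}. int x = lpos (int m) (int k) (int l) j) \<longleftrightarrow> x mod g = 0"
    if "x < k" "1 \<le> x" "g dvd l" for x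
  proof -
    have "j \<noteq> 1" if "int x = lpos (int m) (int k) (int l) j" for j
      using that \<open>1 \<le> x\<close> \<open>g dvd l\<close> lpos_eq[of 1] by auto
    then have "(\<exists>j\<in>{2..int kn}. int x = lpos (int m) (int k) (int l) j) \<longleftrightarrow>
        (\<exists>j\<in>{1..int kn}. int x = lpos (int m) (int k) (int l) j)"
      by (force intro: bexI)
    then show ?thesis using ex1[OF that(1)] that(3) by simp
  qed
  consider (a) "\<not> g dvd l" | (b) "g dvd l" "T 0 = 0" | (c) "g dvd l" "T 0 \<noteq> 0" by blast
  then show ?thesis
  proof cases
    case a
    then have "0 \<notin> P" using P_mod_g[of 0] by auto
    then show ?thesis
      using at0[OF c0] a ex1[OF i(2)] Ntilde2_eq[OF i(2)] card_runner_P_zero[of i]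
      by (auto simp: N2 Let_def T_def)
  next
    case b
    then show ?thesis
      using at0[OF c0] zero_in ex2[OF i(2,1)] Ntilde2_eq[OF i(2)] Ntilde2_eq[of 0] k_pos
        card_runner_P_zero[of i]
      by (auto simp: N2 Let_def T_def)
  next
    case c
    then have "0 \<in> P" using zero_in by simp
    moreover have "1 \<notin> P" using P_mod_g[of 1] c(1) g2 by auto
    ultimately have "c = 1" using gap by (cases c; cases "c - 1") auto
    have T0: "Ntilde2 (int m) (int k) (int l) (int N) 0 = int (T 0)"
      using Ntilde2_eq[of 0] k_pos c(1) by (simp add: T_def)
    \<comment> \<open>Dropping the bead at position 0 turns runner \<open>i + 1\<close> into runner
      \<open>i\<close>, while runner 0 becomes runner \<open>k - 1\<close> and loses that
      bead.\<close>
    have "int (card {x \<in> P. c \<le> x \<and> (x - c) mod k = i}) =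
        (if i + 1 < k then int (T (i + 1)) else int (T 0) - 1)"
      using card_runner_from_gap[OF finite_P flush_k_P gap i(2)] i \<open>c = 1\<close>
      by (auto simp: T_def)
    also have "\<dots> = N_case2 (int m) (int k) (int l) (int N) (int i)"
    proof (cases "i + 1 < k")
      case True
      have "(\<exists>j\<in>{2..int kn}. int i = lpos (int m) (int k) (int l) j - 1) \<longleftrightarrow> (i + 1) mod g = 0"
        using ex2[OF True _ c(1)] by (simp add: algebra_simps)
      then show ?thesis
        using True c T0 Ntilde2_eq[OF True] card_runner_P_zero[of "i + 1"]
        by (auto simp: N2 Let_def T_def algebra_simps)
    next
      case False
      then show ?thesis using c T0 i by (auto simp: N2 Let_def)
    qed
    finally show ?thesis .
  qed
qed

end

theorem theorem4p3:
  fixes N m k l i :: nat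
  assumes "N \<ge> 1" and "m \<ge> 2" and "k \<ge> 2" and "1 \<le> l" and "l < k"
    and "\<not> k dvd m"
    and "1 \<le> i" and "i \<le> k - 1"
  defines "C \<equiv> core m (WH_partition N k l)"
  shows "int (beads k C (length C) i) = N_runner (int m) (int k) (int l) (int N) (int i)"
proof -
  interpret wh_nat m k l N by unfold_locales (use assms in auto)
  note WH = WH_partition_properties[OF \<open>1 \<le> l\<close> \<open>k \<ge> 2\<close>, of N]
  have core: "is_partition C \<and> length C \<le> N \<and> betas C N = P"
    unfolding C_def
    by (rule core_betas[OF m_pos WH(1) _ finite_P flush_m_P]) (simp_all only: WH(2,3) order_refl card_runner_P)
  then have C: "is_partition C" "length C \<le> N" "betas C N = P" by auto
  note beads = beads_eq_card_betas[OF C(1,2), unfolded C(3)]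
  have i: "i < k" using assms by linarith
  show ?thesis
  proof (cases "g = 1")
    case True
    then show ?thesis
      using N_case1_eq_card[OF True beads(2,3) i] beads(1)[of k i]
      unfolding N_runner_def Z.d_def[symmetric] int_g[symmetric] by simp
  next
    case False
    then show ?thesis
      using N_case2_eq_card[OF False beads(2,3) \<open>1 \<le> i\<close> i] beads(1)[of k i]
      unfolding N_runner_def Z.d_def[symmetric] int_g[symmetric] by simp
  qed
qed

end
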